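(* Let $\mathbb{T}$ be a time scale, $a,b\in\mathbb{T}$ with $a<b$, and $\mathbb{T}_\ast:=[a,b]_{\mathbb{T}}$. Let $u:\mathbb{T}_\ast\to\mathbb{R}$ be a nonnegative rd-continuous function, let $h,f:\mathbb{T}_\ast^{\kappa}\to\mathbb{R}$ be nonnegative rd-continuous functions, and let $b(\cdot)$ be a nonnegative rd-continuous function that is not identically zero on $\mathbb{T}_\ast^{\kappa^2}$. Let $\Phi\in C(\mathbb{R}^+_0,\mathbb{R}^+_0)$ be a nondecreasing, subadditive and submultiplicative function such that $\Phi(x)>0$ for $x>0$, and let $W\in C(\mathbb{R}^+_0,\mathbb{R}^+_0)$ be a nondecreasing function such that $W(x)>0$ for $x>0$. Let $g$ belong to the class $S$, and let $a(\cdot):\mathbb{T}_\ast\to(0,\infty)$ be a positive, rd-continuous and nondecreasing function. Suppose that for all $t\in\mathbb{T}_\ast$ $$u(t)\leq a(t)+\int_a^t f(s)g(u(s))\Delta s+\int_a^t f(s)h(s)W\left(\int_a^s b(\tau)\Phi(u(\tau))\Delta\tau\right)\Delta s.$$ Define $$\Psi(x)=\int_{x_0}^x\frac{1}{\Phi(W(s))}\,ds,\quad x>0,\ x_0>0,\qquad G(x)=\int_\delta^x\frac{ds}{g(s)},\quad x>0,\ \delta>0,$$ $$q(t)=G^{-1}\left(G(1)+\int_a^t f(\tau)\Delta\tau\right),\qquad \bar\xi=\int_a^{\rho(b)}b(s)\Phi\left(q(s)\max\{a(s),1\}\right)\Delta s,$$ where $\Psi^{-1}$ and $G^{-1}$ denote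 the inverse functions of $\Psi$ and $G$. Then for all $t\in\mathbb{T}_\ast$ satisfying $$G(1)+\int_a^t f(\tau)\Delta\tau\in \mathrm{Dom}(G^{-1})$$ and $$\Psi(\bar\xi)+\int_a^{\rho(t)}b(\tau)\Phi(q(\tau))\Phi\left(\int_a^\tau f(\theta)h(\theta)\Delta\theta\right)\Delta\tau\in \mathrm{Dom}(\Psi^{-1}),$$ we have $$u(t)\leq q(t)\max\{a(t),1\}+q(t)\int_a^t f(s)h(s)W\left[\Psi^{-1}\left(\Psi(\bar\xi)+\int_a^s b(\tau)\Phi(q(\tau))\Phi\left(\int_a^\tau f(\theta)h(\theta)\Delta\theta\right)\Delta\tau\right)\right]\Delta s.$$
   Context: A time scale $\mathbb{T}$ is a nonempty closed subset of $\mathbb{R}$. $\mathbb{R}^+_0=[0,\infty)$. For $a<b$ in $\mathbb{T}$, $[a,b]_{\mathbb{T}}=\{t\in\mathbb{T}:a\leq t\leq b\}$, and $\mathbb{T}_\ast=[a,b]_{\mathbb{T}}$ is regarded as a time scale itself. On $\mathbb{T}_\ast$: $\sigma(t)=\inf\{s\in\mathbb{T}_\ast:s>t\}$ (with $\sigma(b)=b$), $\rho(t)=\sup\{s\in\mathbb{T}_\ast:s<t\}$ (with $\rho(a)=a$). $\mathbb{T}_\ast^{\kappa}=\mathbb{T}_\ast\setminus\{b\}$ if $\rho(b)<b$ and $\mathbb{T}_\ast^{\kappa}=\mathbb{T}_\ast$ otherwise; $\mathbb{T}_\ast^{\kappa^2}=(\mathbb{T}_\ast^{\kappa})^{\kappa}$.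 $\int\cdot\,\Delta s$ is the delta integral. A function is rd-continuous if it is continuous at right-dense points ($\sigma(t)=t$) and has finite left-sided limits at left-dense points ($\rho(t)=t$). Class $S$: a nondecreasing continuous function $g:\mathbb{R}^+_0\to\mathbb{R}^+_0$ belongs to class $S$ if (1) $g(x)>0$ for $x>0$, and (2) $(1/z)g(x)\leq g(x/z)$ for all $x\geq0$ and $z\geq1$. Subadditive: $\Phi(x+y)\le\Phi(x)+\Phi(y)$; submultiplicative: $\Phi(xy)\le\Phi(x)\Phi(y)$, for all $x,y\ge0$. $\Psi$ and $G$ are defined on $(0,\infty)$ with fixed $x_0>0$, $\delta>0$; $\mathrm{Dom}(\Psi^{-1})$ and $\mathrm{Dom}(G^{-1})$ are the ranges of $\Psi$ and $G$. It is understood that $q(s)$ is defined for the $s$ entering the definition of $\bar\xi$. The functions $a(\cdot)$ and $b(\cdot)$, always written with an argument, are distinct from the endpoints $a$ and $b$; $b(\cdot)$ is defined (at least) on $\mathbb{T}_\ast^{\kappa}$. *)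

theory Defs
  imports "HOL-Analysis.Analysis"
begin

definition time_scale :: "real set \<Rightarrow> bool" where
  "time_scale T \<longleftrightarrow> closed T \<and> T \<noteq> {}"

definition ts_Icc :: "real set \<Rightarrow> real \<Rightarrow> real \<Rightarrow> real set" where
  "ts_Icc T a b = {t \<in> T. a \<le> t \<and> t \<le> b}"

definition fwd_jump :: "real set \<Rightarrow> real \<Rightarrow> real" where
  "fwd_jump T t = (if \<exists>s\<in>T. s > t then Inf {s \<in> T. s > t} else t)"

definition bwd_jump :: "real set \<Rightarrow> real \<Rightarrow> real" where
  "bwd_jump T t = (if \<exists>s\<in>T. s < t then Sup {s \<in> T. s < t} else t)"

text \<open>On a time scale that is bounded above, \<open>Sup T\<close> is its maximum.\<close>

definition ts_kappa :: "real set \<Rightarrow> real set" where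
  "ts_kappa T = (if bdd_above T \<and> bwd_jump T (Sup T) < Sup T then T - {Sup T} else T)"

text \<open>Rd-continuity of a function with domain \<open>D \<subseteq> T\<close> (such as \<open>D = ts_kappa T\<close>); points are
  classified as right-dense or left-dense with respect to \<open>T\<close>.  The maximum of \<open>T\<close> counts as
  right-dense.  The minimum counts as left-dense, where the limit condition is vacuous.\<close>

definition rd_continuous_on :: "real set \<Rightarrow> real set \<Rightarrow> (real \<Rightarrow> real) \<Rightarrow> bool" where
  "rd_continuous_on T D f \<longleftrightarrow>
     (\<forall>t\<in>D. (fwd_jump T t = t \<longrightarrow> continuous (at t within D) f) \<and>
            (bwd_jump T t = t \<longrightarrow> (\<exists>l. (f \<longlongrightarrow> l) (at t within (D \<inter> {..<t})))))"

definition has_delta_derivative :: "real set \<Rightarrow> (real \<Rightarrow> real) \<Rightarrow> real \<Rightarrow> real \<Rightarrow> bool" where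
  "has_delta_derivative T F d t \<longleftrightarrow>
     (\<forall>\<epsilon>>0. \<exists>\<delta>>0. \<forall>s\<in>T. \<bar>s - t\<bar> < \<delta> \<longrightarrow>
        \<bar>F (fwd_jump T t) - F s - d * (fwd_jump T t - s)\<bar> \<le> \<epsilon> * \<bar>fwd_jump T t - s\<bar>)"

text \<open>Pre-antiderivatives and the (Cauchy) delta integral as in Bohner and Peterson, \<open>Dynamic
  Equations on Time Scales\<close>: \<open>F\<close> is continuous and has delta derivative \<open>f\<close> except on a countable
  set without right-scattered points.  The exceptional set is needed even for rd-continuous
  integrands: if \<open>d\<close> is left-dense but right-scattered in \<open>T\<close>, then \<open>f d\<close> may differ from the left
  limit of \<open>f\<close> at \<open>d\<close>, and then no \<open>F\<close> has delta derivative \<open>f d\<close> at \<open>d\<close> within \<open>ts_Icc T c d\<close>.\<close>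

definition pre_antiderivative :: "real set \<Rightarrow> (real \<Rightarrow> real) \<Rightarrow> (real \<Rightarrow> real) \<Rightarrow> bool" where
  "pre_antiderivative T f F \<longleftrightarrow> continuous_on T F \<and>
     (\<exists>D\<subseteq>ts_kappa T. countable (ts_kappa T - D) \<and>
        (\<forall>t\<in>ts_kappa T - D. fwd_jump T t = t) \<and>
        (\<forall>t\<in>D. has_delta_derivative T F (f t) t))"

text \<open>The interval of integration is treated as a time scale of its own, so that the integrand only
  has to be meaningful on that interval.  Used for \<open>c \<le> d\<close> in \<open>T\<close> only.\<close>

definition delta_integral :: "real set \<Rightarrow> real \<Rightarrow> real \<Rightarrow> (real \<Rightarrow> real) \<Rightarrow> real" where
  "delta_integral T c d f =
     (THE I. \<exists>F. pre_antiderivative (ts_Icc T c d) f F \<and> I = F d - F c)"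

definition class_S :: "(real \<Rightarrow> real) \<Rightarrow> bool" where
  "class_S g \<longleftrightarrow> continuous_on {0..} g \<and> g ` {0..} \<subseteq> {0..} \<and> mono_on {0..} g \<and>
     (\<forall>x>0. g x > 0) \<and> (\<forall>x\<ge>0. \<forall>z\<ge>1. (1 / z) * g x \<le> g (x / z))"

end

theory Submission
  imports Defs
begin

text \<open>
  Extending an integrand constantly across the gaps of the time scale turns its delta integral into
  an ordinary integral.  Since the extension of a function is evaluated to the left of the current
  point and the bounding functions are nondecreasing, the Gronwall-Bihari inequality on a time scale
  follows from the one on the real line.

  It is applied twice.  Put \<open>B s = \<integral> \<beta> \<Phi>(u)\<close> over \<open>[a, s)\<close> and
  \<open>n t = max (\<alpha> t) 1 + \<integral> f h W(B)\<close> over \<open>[a, t)\<close>.  As \<open>n\<close> is nondecreasing and at least \<open>1\<close>, the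
  property of class \<open>S\<close> gives \<open>u/n \<le> 1 + \<integral> f g(u/n)\<close>, hence \<open>u \<le> q n\<close>.  Inserting this bound into
  \<open>B\<close> and using that \<open>\<Phi>\<close> is subadditive and submultiplicative gives
  \<open>B \<le> \<xi> + \<integral> \<beta> \<Phi>(q) \<Phi>(\<integral> f h) \<Phi>(W(B))\<close>, and the second application bounds \<open>B\<close> by \<open>\<Psi>\<^sup>-\<^sup>1(\<dots>)\<close>.
\<close>

section \<open>Uniqueness of pre-antiderivatives\<close>

text \<open>\<open>delta_integral\<close> is a definite description over pre-antiderivatives, so
  nothing can be computed before these are known to exist and to be unique up to a constant.
  Existence comes from the ordinary integral of the extended integrand. Uniqueness has to tolerate
  countably many right-dense points without any derivative, which rules out a plain mean value
  argument.

  The extended integrands are discontinuous, so their primitives need not be differentiable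
  everywhere; the Bihari inequality is therefore obtained by subdividing the interval instead of
  integrating a differential inequality.

  Two effects at the ends shape the bookkeeping. The value of an integrand at the upper limit does
  not affect the integral and may be irregular, so regularity and comparison of integrands are
  confined to points strictly to the left of it. The inverses of \<open>G\<close> and
  \<open>\<Psi>\<close> are meaningful only on the ranges of these functions; a range condition at
  the largest argument is passed down to smaller ones by the intermediate value theorem.\<close>

lemma fwd_jump_props:
  assumes "closed S" "t \<in> S" "b \<in> S" "t < b"
  shows fwd_jump_in: "fwd_jump S t \<in> S"
    and fwd_jump_ge: "t \<le> fwd_jump S t"
    and fwd_jump_le: "\<And>s. s \<in> S \<Longrightarrow> t < s \<Longrightarrow> fwd_jump S t \<le> s"
    and fwd_jump_dense: "\<And>d. fwd_jump S t = t \<Longrightarrow> d > 0 \<Longrightarrow> \<exists>s\<in>S. t < s \<and> s < t + d"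
proof -
  let ?X = "{s \<in> S. t < s}"
  have eq: "fwd_jump S t = Inf ?X"
    using assms by (auto simp: fwd_jump_def)
  have ne: "?X \<noteq> {}" using assms by auto
  have bb: "bdd_below ?X" by (auto intro!: bdd_belowI[of _ t])
  have "Inf ?X \<in> closure ?X" using closure_contains_Inf[OF ne bb] .
  also have "\<dots> \<subseteq> closure S" by (intro closure_mono) auto
  finally show "fwd_jump S t \<in> S" using eq assms(1) by simp
  show "t \<le> fwd_jump S t"
    unfolding eq using ne by (intro cInf_greatest) auto
  show "fwd_jump S t \<le> s" if "s \<in> S" "t < s" for s
    unfolding eq using that bb by (intro cInf_lower) auto
  show "\<exists>s\<in>S. t < s \<and> s < t + d" if "fwd_jump S t = t" "d > 0" for d
    using cInf_lessD[OF ne, of "t + d"] that eq by auto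
qed

lemma bwd_jump_max:
  assumes "closed S" "b \<in> S"
  shows bwd_jump_in: "bwd_jump S b \<in> S"
    and bwd_jump_le: "bwd_jump S b \<le> b"
    and bwd_jump_ge: "\<And>s. s \<in> S \<Longrightarrow> s < b \<Longrightarrow> s \<le> bwd_jump S b"
proof -
  let ?X = "{s \<in> S. s < b}"
  have bb: "bdd_above ?X" by (auto intro!: bdd_aboveI[of _ b])
  show "bwd_jump S b \<in> S"
  proof (cases "?X = {}")
    case True
    then show ?thesis using assms by (auto simp: bwd_jump_def)
  next
    case False
    have "Sup ?X \<in> closure ?X" using closure_contains_Sup[OF False bb] .
    also have "\<dots> \<subseteq> closure S" by (intro closure_mono) auto
    finally show ?thesis using assms(1) False by (auto simp: bwd_jump_def)
  qed
  show "bwd_jump S b \<le> b"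
    by (auto simp: bwd_jump_def intro!: cSup_least)
  show "s \<le> bwd_jump S b" if "s \<in> S" "s < b" for s
    using that bb by (auto simp: bwd_jump_def intro!: cSup_upper)
qed

text \<open>Either \<open>bwd_jump S b = b\<close> and the cut removes nothing, or there is a gap
  directly below \<open>b\<close> and the cut removes exactly \<open>b\<close>. The uniform form
  spares the case split and can be iterated for \<open>ts_kappa (ts_kappa S)\<close>.\<close>

lemma ts_kappa_eq:
  assumes "closed S" "b \<in> S" "S \<subseteq> {..b}"
  shows "ts_kappa S = S \<inter> {..bwd_jump S b}"
proof -
  have sup: "Sup S = b" and bdd: "bdd_above S"
    using assms by (auto intro!: cSup_eq_maximum bdd_aboveI[of _ b])
  note bj = bwd_jump_max[OF assms(1,2)]
  show ?thesis
  proof (cases "bwd_jump S b < b")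
    case True
    then show ?thesis
      using bj assms by (force simp: ts_kappa_def sup bdd)
  next
    case False
    then have "bwd_jump S b = b" using bj by auto
    then show ?thesis using assms by (auto simp: ts_kappa_def sup bdd)
  qed
qed

text \<open>A finite measure on index sets that charges every index: adding an index raises it by a
  definite amount, while the total never exceeds 2.\<close>

definition half_weight :: "nat set \<Rightarrow> real" where
  "half_weight N = (\<Sum>n. if n \<in> N then (1/2)^n else 0)"

lemma half_weight_summable: "summable (\<lambda>n. if n \<in> N then (1/2)^n else (0::real))"
  by (rule summable_comparison_test[OF _ complete_algebra_summable_geometric[of "1/2::real"]]) auto

lemma half_weight_nonneg: "0 \<le> half_weight N"
  unfolding half_weight_def by (intro suminf_nonneg half_weight_summable) auto

lemma half_weight_le: "half_weight N \<le> 2"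
proof -
  have "half_weight N \<le> (\<Sum>n. (1/2)^n)"
    unfolding half_weight_def
    by (intro suminf_le half_weight_summable complete_algebra_summable_geometric) auto
  then show ?thesis by (simp add: suminf_geometric)
qed

lemma half_weight_mono: "N \<subseteq> M \<Longrightarrow> half_weight N \<le> half_weight M"
  unfolding half_weight_def by (intro suminf_le half_weight_summable) auto

lemma half_weight_jump:
  assumes "k \<notin> N" "insert k N \<subseteq> M"
  shows "half_weight N + (1/2)^k \<le> half_weight M"
proof -
  have "(\<lambda>n. (if n \<in> N then (1/2)^n else (0::real)) + (if n = k then (1/2)^n else 0)) sums
      (half_weight N + (1/2)^k)"
    unfolding half_weight_def
    by (intro sums_add summable_sums half_weight_summable sums_single)
  also have "(\<lambda>n. (if n \<in> N then (1/2)^n else (0::real)) + (if n = k then (1/2)^n else 0))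
      = (\<lambda>n. if n \<in> insert k N then (1/2)^n else 0)"
    using assms(1) by auto
  finally have "half_weight N + (1/2)^k = half_weight (insert k N)"
    unfolding half_weight_def by (rule sums_unique)
  then show ?thesis using half_weight_mono[OF assms(2)] by simp
qed

text \<open>The weights \<open>\<epsilon> * (1/2)^n\<close> allow a jump at each of the countably many exceptional points, so
  that the bound \<open>w\<close> below propagates through right-dense points where \<open>H\<close> is merely continuous.\<close>

lemma zero_delta_derivative_imp_eq:
  fixes H :: "real \<Rightarrow> real"
  assumes S: "closed S" "S \<subseteq> {a..b}" "a \<in> S" "b \<in> S"
    and cont: "continuous_on S H"
    and E: "countable E" "\<And>t. t \<in> E \<Longrightarrow> t < b \<Longrightarrow> fwd_jump S t = t"
    and der: "\<And>t. t \<in> S \<Longrightarrow> t < b \<Longrightarrow> t \<notin> E \<Longrightarrow> has_delta_derivative S H 0 t"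
  shows "H b = H a"
proof -
  have key: "\<bar>H b - H a\<bar> \<le> \<epsilon> * (b - a + 2)" if "\<epsilon> > 0" for \<epsilon>
  proof -
    define num where "num = to_nat_on E"
    \<comment> \<open>The error budget: slope \<epsilon> for points with derivative 0, and a jump
      for each exceptional point. The strict \<open>{..<x}\<close> places the jump of an exceptional
      point immediately to its right, where it is spent.\<close>
    define w where "w x = \<epsilon> * (x - a) + \<epsilon> * half_weight (num ` (E \<inter> {..<x}))" for x
    have inj: "inj_on num E" using E(1) by (simp add: num_def inj_on_to_nat_on)
    have w_mono: "w x + \<epsilon> * (y - x) \<le> w y" if "x \<le> y" for x y
    proof -
      have "half_weight (num ` (E \<inter> {..<x})) \<le> half_weight (num ` (E \<inter> {..<y}))"
        using that by (intro half_weight_mono image_mono) auto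
      then show ?thesis using \<open>\<epsilon> > 0\<close> by (simp add: w_def algebra_simps)
    qed
    have w_mono': "w x \<le> w y" if "x \<le> y" for x y
      using w_mono[OF that] \<open>\<epsilon> > 0\<close> that by (smt (verit) mult_nonneg_nonneg)
    have w_jump: "w x + \<epsilon> * (1/2)^(num x) \<le> w y" if "x < y" "x \<in> E" for x y
    proof -
      have "num x \<notin> num ` (E \<inter> {..<x})" using inj that by (auto simp: inj_on_def)
      then have "half_weight (num ` (E \<inter> {..<x})) + (1/2)^(num x) \<le> half_weight (num ` (E \<inter> {..<y}))"
        using that by (intro half_weight_jump) auto
      then have "\<epsilon> * (half_weight (num ` (E \<inter> {..<x})) + (1/2)^(num x))
          \<le> \<epsilon> * half_weight (num ` (E \<inter> {..<y}))"
        using \<open>\<epsilon> > 0\<close> by (intro mult_left_mono) auto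
      moreover have "\<epsilon> * (x - a) \<le> \<epsilon> * (y - a)" using \<open>\<epsilon> > 0\<close> that by auto
      ultimately show ?thesis by (simp add: w_def algebra_simps)
    qed
    \<comment> \<open>Continuous induction: the supremum \<open>m\<close> of the points up to which
      the budget is kept belongs to this set, and \<open>m < b\<close> would allow a further step to
      the right.\<close>
    define A where "A = {x \<in> S. \<forall>y\<in>S. y \<le> x \<longrightarrow> \<bar>H y - H a\<bar> \<le> w y}"
    have "0 \<le> w a" using \<open>\<epsilon> > 0\<close> by (auto simp: w_def half_weight_nonneg)
    then have aA: "a \<in> A" using S by (force simp: A_def)
    have bdd: "bdd_above A" using S by (auto simp: A_def intro!: bdd_aboveI[of _ b])
    define m where "m = Sup A"
    have "m \<in> closure A" unfolding m_def using aA bdd by (intro closure_contains_Sup) auto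
    also have "closure A \<subseteq> closure S" by (intro closure_mono) (auto simp: A_def)
    finally have mS: "m \<in> S" using S by simp
    have upper: "x \<le> m" if "x \<in> A" for x using that bdd by (auto simp: m_def intro!: cSup_upper)
    have near: "\<exists>x\<in>A. y < x" if "y < m" for y
      using less_cSupD[of A y] that aA by (auto simp: m_def)
    \<comment> \<open>The bound survives the limit from the left because \<open>H\<close> is
      continuous and \<open>w\<close> is nondecreasing; \<open>w\<close> itself may jump.\<close>
    have wm: "\<bar>H m - H a\<bar> \<le> w m"
    proof (rule ccontr)
      assume neg: "\<not> \<bar>H m - H a\<bar> \<le> w m"
      define r where "r = \<bar>H m - H a\<bar> - w m"
      have "r > 0" using neg by (simp add: r_def)
      then obtain d where d: "d > 0" "\<And>y. y \<in> S \<Longrightarrow> \<bar>y - m\<bar> < d \<Longrightarrow> \<bar>H y - H m\<bar> < r"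
        using cont mS unfolding continuous_on_iff dist_real_def by meson
      obtain x where x: "x \<in> A" "m - d < x" using near[of "m - d"] d(1) by auto
      then have "\<bar>H x - H m\<bar> < r" using d upper by (auto simp: A_def)
      moreover have "\<bar>H x - H a\<bar> \<le> w x" using x by (auto simp: A_def)
      moreover have "w x \<le> w m" using upper x by (intro w_mono') auto
      ultimately show False by (auto simp: r_def)
    qed
    have below: "\<bar>H y - H a\<bar> \<le> w y" if "y \<in> S" "y \<le> m" for y
      using near[of y] that wm by (cases "y = m") (force simp: A_def)+
    have "m = b"
    proof (rule ccontr)
      assume "m \<noteq> b"
      then have mb: "m < b" using mS S by force
      note fj = fwd_jump_props[OF S(1) mS S(4) mb]
      show False
      proof (cases "fwd_jump S m = m")
        case False
        then have "m \<notin> E" using E mb by auto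
        \<comment> \<open>The definition of the delta derivative with \<open>s = m\<close> controls
          the increment across the whole gap.\<close>
        then have "\<bar>H (fwd_jump S m) - H m\<bar> \<le> \<epsilon> * \<bar>fwd_jump S m - m\<bar>"
          using der[OF mS mb] \<open>\<epsilon> > 0\<close> mS by (fastforce simp: has_delta_derivative_def)
        then have "\<bar>H (fwd_jump S m) - H a\<bar> \<le> w (fwd_jump S m)"
          using wm w_mono[OF fj(2)] fj(2) by auto
        then have "fwd_jump S m \<in> A"
          using below fj by (force simp: A_def)
        then show False using upper fj(2) False by force
      next
        case True
        have "\<exists>d>0. \<forall>s\<in>S. m < s \<and> s < m + d \<longrightarrow> \<bar>H s - H m\<bar> \<le> w s - w m"
        proof (cases "m \<in> E")
          case False
          then obtain d where d: "d > 0" "\<And>s. s \<in> S \<Longrightarrow> \<bar>s - m\<bar> < d \<Longrightarrow> \<bar>H m - H s\<bar> \<le> \<epsilon> * \<bar>m - s\<bar>"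
            using der[OF mS mb] \<open>\<epsilon> > 0\<close> True by (fastforce simp: has_delta_derivative_def)
          have "\<bar>H s - H m\<bar> \<le> w s - w m" if "s \<in> S" "m < s" "s < m + d" for s
            using d(2)[of s] w_mono[of m s] that by auto
          then show ?thesis using d(1) by blast
        next
          case True
          have "\<epsilon> * (1/2)^(num m) > 0" using \<open>\<epsilon> > 0\<close> by simp
          then obtain d where d: "d > 0" "\<And>s. s \<in> S \<Longrightarrow> \<bar>s - m\<bar> < d \<Longrightarrow> \<bar>H s - H m\<bar> < \<epsilon> * (1/2)^(num m)"
            using cont mS unfolding continuous_on_iff dist_real_def by meson
          have "\<bar>H s - H m\<bar> \<le> w s - w m" if "s \<in> S" "m < s" "s < m + d" for s
            using d(2)[of s] w_jump[of m s] that True by auto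
          then show ?thesis using d(1) by blast
        qed
        then obtain d where d: "d > 0" "\<And>s. s \<in> S \<Longrightarrow> m < s \<Longrightarrow> s < m + d \<Longrightarrow> \<bar>H s - H m\<bar> \<le> w s - w m"
          by blast
        obtain s where s: "s \<in> S" "m < s" "s < m + d" using fj(4)[OF True d(1)] by auto
        have "\<bar>H y - H a\<bar> \<le> w y" if "y \<in> S" "y \<le> s" for y
        proof (cases "y \<le> m")
          case False
          then have "\<bar>H y - H m\<bar> \<le> w y - w m" using d(2) that s by auto
          then show ?thesis using wm by auto
        qed (use below that in auto)
        then have "s \<in> A" using s by (auto simp: A_def)
        then show False using upper s by force
      qed
    qed
    then have "\<bar>H b - H a\<bar> \<le> w b" using wm by simp
    also have "\<dots> \<le> \<epsilon> * (b - a) + \<epsilon> * 2"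
      using \<open>\<epsilon> > 0\<close> half_weight_le by (auto simp: w_def)
    finally show ?thesis by (simp add: algebra_simps)
  qed
  have ab: "a \<le> b" using S by auto
  show ?thesis
  proof (rule ccontr)
    assume "H b \<noteq> H a"
    then have pos: "\<bar>H b - H a\<bar> > 0" by simp
    have c: "b - a + 2 > 0" using ab by simp
    have half: "x / (2 * c) * c = x / 2" if "c > 0" for x c :: real using that by simp
    have "\<bar>H b - H a\<bar> / (2 * (b - a + 2)) > 0" using pos c by (intro divide_pos_pos) auto
    from key[OF this] have "\<bar>H b - H a\<bar> \<le> \<bar>H b - H a\<bar> / (2 * (b - a + 2)) * (b - a + 2)" .
    also have "\<dots> = \<bar>H b - H a\<bar> / 2" using half[OF c] .
    finally have "\<bar>H b - H a\<bar> \<le> \<bar>H b - H a\<bar> / 2" .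
    then show False using pos by simp
  qed
qed

lemma has_delta_derivative_diff:
  assumes "has_delta_derivative S F d t" "has_delta_derivative S F' d' t"
  shows "has_delta_derivative S (\<lambda>x. F x - F' x) (d - d') t"
  unfolding has_delta_derivative_def
proof (intro allI impI)
  fix \<epsilon> :: real assume "\<epsilon> > 0"
  let ?\<sigma> = "fwd_jump S t"
  obtain r where r: "r > 0" "\<And>s. s \<in> S \<Longrightarrow> \<bar>s - t\<bar> < r \<Longrightarrow> \<bar>F ?\<sigma> - F s - d * (?\<sigma> - s)\<bar> \<le> (\<epsilon>/2) * \<bar>?\<sigma> - s\<bar>"
    using assms(1) \<open>\<epsilon> > 0\<close> unfolding has_delta_derivative_def by (meson half_gt_zero)
  obtain r' where r': "r' > 0" "\<And>s. s \<in> S \<Longrightarrow> \<bar>s - t\<bar> < r' \<Longrightarrow> \<bar>F' ?\<sigma> - F' s - d' * (?\<sigma> - s)\<bar> \<le> (\<epsilon>/2) * \<bar>?\<sigma> - s\<bar>"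
    using assms(2) \<open>\<epsilon> > 0\<close> unfolding has_delta_derivative_def by (meson half_gt_zero)
  show "\<exists>r>0. \<forall>s\<in>S. \<bar>s - t\<bar> < r \<longrightarrow>
      \<bar>F ?\<sigma> - F' ?\<sigma> - (F s - F' s) - (d - d') * (?\<sigma> - s)\<bar> \<le> \<epsilon> * \<bar>?\<sigma> - s\<bar>"
  proof (intro exI[of _ "min r r'"] conjI ballI impI)
    fix s assume "s \<in> S" "\<bar>s - t\<bar> < min r r'"
    then have "\<bar>F ?\<sigma> - F s - d * (?\<sigma> - s)\<bar> \<le> (\<epsilon>/2) * \<bar>?\<sigma> - s\<bar>"
        "\<bar>F' ?\<sigma> - F' s - d' * (?\<sigma> - s)\<bar> \<le> (\<epsilon>/2) * \<bar>?\<sigma> - s\<bar>"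
      using r(2)[of s] r'(2)[of s] by auto
    then show "\<bar>F ?\<sigma> - F' ?\<sigma> - (F s - F' s) - (d - d') * (?\<sigma> - s)\<bar> \<le> \<epsilon> * \<bar>?\<sigma> - s\<bar>"
      unfolding left_diff_distrib by linarith
  qed (use r r' in auto)
qed

text \<open>The difference of two pre-antiderivatives has delta derivative 0 off the union of their
  exceptional sets, which is again countable and free of right-scattered points. This gives
  \<open>delta_integral\<close> a well-defined value.\<close>

lemma pre_antiderivative_unique:
  assumes S: "closed S" "S \<subseteq> {a..b}" "a \<in> S" "b \<in> S"
    and F: "pre_antiderivative S f F" "pre_antiderivative S f F'"
  shows "F b - F a = F' b - F' a"
proof -
  obtain D where D: "countable (ts_kappa S - D)" "\<forall>t\<in>ts_kappa S - D. fwd_jump S t = t"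
      "\<forall>t\<in>D. has_delta_derivative S F (f t) t"
    using F(1) by (auto simp: pre_antiderivative_def)
  obtain D' where D': "countable (ts_kappa S - D')" "\<forall>t\<in>ts_kappa S - D'. fwd_jump S t = t"
      "\<forall>t\<in>D'. has_delta_derivative S F' (f t) t"
    using F(2) by (auto simp: pre_antiderivative_def)
  have kap: "t \<in> ts_kappa S" if "t \<in> S" "t < b" for t
    using that S bwd_jump_ge[OF S(1,4)] by (subst ts_kappa_eq[OF S(1,4)]) auto
  have "F b - F' b = F a - F' a"
  proof (rule zero_delta_derivative_imp_eq[OF S, of "\<lambda>x. F x - F' x" "(ts_kappa S - D) \<union> (ts_kappa S - D')"])
    show "continuous_on S (\<lambda>x. F x - F' x)"
      using F by (auto simp: pre_antiderivative_def intro!: continuous_intros)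
    show "has_delta_derivative S (\<lambda>x. F x - F' x) 0 t"
      if "t \<in> S" "t < b" "t \<notin> (ts_kappa S - D) \<union> (ts_kappa S - D')" for t
      using has_delta_derivative_diff[of S F "f t" t F' "f t"] D(3) D'(3) that kap[of t] by auto
  qed (use D D' in auto)
  then show ?thesis by simp
qed

section \<open>The delta integral as an ordinary integral\<close>

locale compact_time_scale =
  fixes S :: "real set" and a b :: real
  assumes closed_S: "closed S" and S_bounds: "S \<subseteq> {a..b}" and a_in: "a \<in> S" and b_in: "b \<in> S"
begin

text \<open>\<open>\<lambda>x. \<phi> (floor_pt x)\<close> extends \<open>\<phi>\<close> constantly across the gaps of \<open>S\<close>.\<close>

definition floor_pt :: "real \<Rightarrow> real" where
  "floor_pt x = Sup {s \<in> S. s \<le> x}"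

lemma a_le: "s \<in> S \<Longrightarrow> a \<le> s" and le_b: "s \<in> S \<Longrightarrow> s \<le> b"
  using S_bounds by auto

lemma floor_pt_in: "a \<le> x \<Longrightarrow> floor_pt x \<in> S"
  and floor_pt_le: "a \<le> x \<Longrightarrow> floor_pt x \<le> x"
  and le_floor_pt: "s \<in> S \<Longrightarrow> s \<le> x \<Longrightarrow> s \<le> floor_pt x"
proof -
  have bb: "bdd_above {s \<in> S. s \<le> x}" for x by (auto intro!: bdd_aboveI[of _ x])
  show "floor_pt x \<in> S" if "a \<le> x"
  proof -
    have ne: "{s \<in> S. s \<le> x} \<noteq> {}" using that a_in by auto
    have "Sup {s \<in> S. s \<le> x} \<in> closure {s \<in> S. s \<le> x}"
      using closure_contains_Sup[OF ne bb] .
    also have "\<dots> \<subseteq> closure S" by (intro closure_mono) auto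
    finally show ?thesis using closed_S by (simp add: floor_pt_def)
  qed
  show "floor_pt x \<le> x" if "a \<le> x"
    unfolding floor_pt_def using that a_in by (intro cSup_least) auto
  show "s \<le> floor_pt x" if "s \<in> S" "s \<le> x"
    unfolding floor_pt_def using that bb by (intro cSup_upper) auto
qed

lemma floor_pt_id: "s \<in> S \<Longrightarrow> floor_pt s = s"
  using floor_pt_le[of s] le_floor_pt[of s s] a_le[of s] by auto

lemma a_le_floor_pt: "a \<le> x \<Longrightarrow> a \<le> floor_pt x"
  using floor_pt_in a_le by blast

lemma fwd_jump_eq_b: "fwd_jump S b = b"
  using le_b by (force simp: fwd_jump_def)

text \<open>The gaps to the right of right-scattered points are nonempty, pairwise disjoint open
  intervals, and each determines its left end.\<close>

lemma countable_scattered: "countable {t \<in> S. fwd_jump S t \<noteq> t}"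
proof -
  let ?N = "{t \<in> S. fwd_jump S t \<noteq> t}"
  let ?I = "\<lambda>t. {t<..<fwd_jump S t}"
  have fj: "t < fwd_jump S t" "\<And>s. s \<in> S \<Longrightarrow> t < s \<Longrightarrow> fwd_jump S t \<le> s" if "t \<in> ?N" for t
  proof -
    have t: "t \<in> S" "fwd_jump S t \<noteq> t" using that by auto
    then have "t < b" using fwd_jump_eq_b le_b[of t] by (cases "t = b") auto
    note fj = fwd_jump_props[OF closed_S t(1) b_in this]
    show "t < fwd_jump S t" using fj(2) t(2) by simp
    show "fwd_jump S t \<le> s" if "s \<in> S" "t < s" for s using fj(3) that .
  qed
  have inj: "inj_on ?I ?N"
  proof (rule inj_onI)
    fix s t assume st: "s \<in> ?N" "t \<in> ?N" "?I s = ?I t"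
    have "s = Inf (?I s)" using fj(1)[OF st(1)] by (rule cInf_greaterThanLessThan[symmetric])
    also have "\<dots> = Inf (?I t)" by (rule arg_cong[OF st(3)])
    also have "\<dots> = t" using fj(1)[OF st(2)] by (rule cInf_greaterThanLessThan)
    finally show "s = t" .
  qed
  have "countable (?I ` ?N)"
  proof (rule countable_disjoint_open_subsets)
    show "pairwise disjnt (?I ` ?N)"
    proof (rule pairwise_imageI)
      fix s t assume st: "s \<in> ?N" "t \<in> ?N" "s \<noteq> t"
      have "fwd_jump S s \<le> t \<or> fwd_jump S t \<le> s"
      proof (cases "s < t")
        case True
        then show ?thesis using fj(2)[OF st(1), of t] st(2) by blast
      next
        case False
        then have "t < s" using st(3) by simp
        then show ?thesis using fj(2)[OF st(2), of s] st(1) by blast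
      qed
      then show "disjnt (?I s) (?I t)" by (auto simp: disjnt_iff)
    qed
    show "open X" if "X \<in> ?I ` ?N" for X using that by (elim imageE) simp
  qed
  then show ?thesis using inj by (rule countable_image_inj_on)
qed

text \<open>A weakening of rd-continuity on \<open>S \<inter> {..<e}\<close>: boundedness is all that the delta integral up to \<open>e\<close>
  needs of the left limits, and it is easier to preserve.\<close>

definition rdc :: "real \<Rightarrow> (real \<Rightarrow> real) \<Rightarrow> bool" where
  "rdc e \<phi> \<longleftrightarrow> bounded (\<phi> ` (S \<inter> {..<e})) \<and>
     (\<forall>t\<in>S \<inter> {..<e}. fwd_jump S t = t \<longrightarrow> continuous (at t within S \<inter> {..<e}) \<phi>)"

text \<open>The interval splits into countably many Borel pieces: the half-open gaps and
  \<open>{b}\<close>, on which the extension is constant, and the set \<open>R\<close> of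
  right-dense points below \<open>b\<close>, on which \<open>floor_pt\<close> is the identity and
  \<open>\<phi>\<close> is continuous. \<open>R\<close> is Borel because only countably many points
  of \<open>S\<close> are right-scattered.\<close>

lemma measurable_floor_pt:
  assumes "rdc b \<phi>"
  shows "(\<lambda>x. \<phi> (floor_pt x)) \<in> borel_measurable (restrict_space borel {a..b})"
proof -
  let ?N = "{t \<in> S. fwd_jump S t \<noteq> t}"
  define R where "R = S \<inter> {..<b} - ?N"
  define J where "J t = (if t = b then {b} else {t..<fwd_jump S t})" for t
  let ?C = "insert R (J ` (insert b ?N))"
  have jump: "t < fwd_jump S t \<and> t < b \<and> fwd_jump S t \<le> b \<and> (\<forall>s\<in>S. t < s \<longrightarrow> fwd_jump S t \<le> s)" 
    if "t \<in> ?N" for t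
  proof -
    have "t < b" using that fwd_jump_eq_b le_b[of t] by (cases "t = b") auto
    then show ?thesis
      using fwd_jump_props[OF closed_S _ b_in, of t] that b_in by auto
  qed
  have Jval: "floor_pt x = t" if "t \<in> insert b ?N" "x \<in> J t" for x t
  proof (cases "t = b")
    case True
    then show ?thesis using that floor_pt_id b_in by (auto simp: J_def)
  next
    case False
    then have t: "t \<in> ?N" "t \<le> x" "x < fwd_jump S t" using that by (auto simp: J_def)
    then have "a \<le> x" using a_le by force
    have "floor_pt x \<le> t"
      using jump[OF t(1)] floor_pt_in[OF \<open>a \<le> x\<close>] floor_pt_le[OF \<open>a \<le> x\<close>] t by force
    then show ?thesis using le_floor_pt[of t x] t by auto
  qed
  have Rval: "floor_pt x = x" if "x \<in> R" for x
    using that floor_pt_id by (auto simp: R_def)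
  have subJ: "J t \<subseteq> {a..b}" if "t \<in> insert b ?N" for t
    using that jump[of t] a_le[of t] a_le[OF b_in] by (cases "t = b") (auto simp: J_def)
  have cover: "{a..b} \<subseteq> \<Union> ?C"
  proof
    fix x assume x: "x \<in> {a..b}"
    show "x \<in> \<Union> ?C"
    proof (cases "x = b")
      case True
      then show ?thesis by (auto simp: J_def)
    next
      case False
      let ?t = "floor_pt x"
      have t: "?t \<in> S" "?t \<le> x" "x < b" using x False floor_pt_in floor_pt_le by auto
      show ?thesis
      proof (cases "fwd_jump S ?t = ?t")
        case dense: True
        have "x = ?t"
        proof (rule ccontr)
          assume "x \<noteq> ?t"
          then have "?t < x" using t by auto
          then obtain s where "s \<in> S" "?t < s" "s < ?t + (x - ?t)"
            using fwd_jump_dense[OF closed_S t(1) b_in, of "x - ?t"] dense t by auto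
          then show False using le_floor_pt[of s x] by auto
        qed
        then have "x \<in> R" using t dense by (auto simp: R_def)
        then show ?thesis by auto
      next
        case False
        then have N: "?t \<in> ?N" using t by auto
        have "x < fwd_jump S ?t"
        proof (rule ccontr)
          assume "\<not> x < fwd_jump S ?t"
          then have "fwd_jump S ?t \<le> ?t"
            using fwd_jump_in[OF closed_S t(1) b_in] jump[OF N] by (intro le_floor_pt) auto
          then show False using jump[OF N] by simp
        qed
        then have "x \<in> J ?t" using t jump[OF N] by (auto simp: J_def)
        then show ?thesis using N by blast
      qed
    qed
  qed
  have Rborel: "R \<in> sets borel"
  proof -
    have "?N \<in> sets borel"
      by (rule sets.countable[OF _ countable_scattered]) simp
    then show ?thesis
      unfolding R_def using borel_closed[OF closed_S] by (intro sets.Diff sets.Int) simp_all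
  qed
  show ?thesis
  proof (rule measurable_piecewise_restrict[of ?C])
    show "countable ?C" using countable_scattered by auto
    show "X \<inter> space (restrict_space borel {a..b}) \<in> sets (restrict_space borel {a..b})" if "X \<in> ?C" for X
    proof -
      have "X \<in> sets borel" using that Rborel by (auto simp: J_def)
      then show ?thesis by (auto simp: sets_restrict_space space_restrict_space)
    qed
    show "space (restrict_space borel {a..b}) \<subseteq> \<Union> ?C"
      using cover by (simp add: space_restrict_space)
    show "(\<lambda>x. \<phi> (floor_pt x)) \<in> borel_measurable (restrict_space (restrict_space borel {a..b}) X)"
      if X: "X \<in> ?C" for X
    proof -
      have Xs: "X \<subseteq> {a..b}" using X subJ S_bounds by (auto simp: R_def)
      moreover have "X \<in> sets borel" using X Rborel by (auto simp: J_def)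
      ultimately have eq: "restrict_space (restrict_space borel {a..b}) X = restrict_space borel X"
        by (subst restrict_restrict_space) (auto simp: Int_absorb1)
      consider "X = R" | t where "t \<in> insert b ?N" "X = J t" using X by auto
      then show ?thesis
      proof cases
        case 1
        have "continuous_on R \<phi>"
          unfolding continuous_on_eq_continuous_within
        proof
          fix x assume x: "x \<in> R"
          then have "continuous (at x within S \<inter> {..<b}) \<phi>" using assms by (auto simp: rdc_def R_def)
          then show "continuous (at x within R) \<phi>"
            by (rule continuous_within_subset) (auto simp: R_def)
        qed
        then have "\<phi> \<in> borel_measurable (restrict_space borel R)"
          by (rule borel_measurable_continuous_on_restrict)
        moreover have "(\<lambda>x. \<phi> (floor_pt x)) \<in> borel_measurable (restrict_space borel R) \<longleftrightarrow>
            \<phi> \<in> borel_measurable (restrict_space borel R)"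
          by (rule measurable_cong) (simp add: space_restrict_space Rval)
        ultimately show ?thesis unfolding eq[unfolded 1] 1 by simp
      next
        case 2
        have "(\<lambda>x. \<phi> (floor_pt x)) \<in> borel_measurable (restrict_space borel X) \<longleftrightarrow>
            (\<lambda>x. \<phi> t) \<in> borel_measurable (restrict_space borel X)"
          by (rule measurable_cong) (simp add: space_restrict_space 2(2) Jval[OF 2(1)])
        then show ?thesis unfolding eq by simp
      qed
    qed
  qed
qed

lemma rdc_bounded_floor_pt:
  assumes "rdc b \<phi>"
  shows "\<exists>K>0. \<forall>x\<in>{a..b}. \<bar>\<phi> (floor_pt x)\<bar> \<le> K"
proof -
  have "bounded (insert (\<phi> b) (\<phi> ` (S \<inter> {..<b})))" using assms by (auto simp: rdc_def)
  moreover have "\<phi> ` S \<subseteq> insert (\<phi> b) (\<phi> ` (S \<inter> {..<b}))"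
    using le_b by (auto simp: image_iff less_le)
  ultimately have "bounded (\<phi> ` S)" by (rule bounded_subset)
  then obtain K where "K > 0" "\<forall>s\<in>S. \<bar>\<phi> s\<bar> \<le> K"
    by (auto simp: bounded_pos)
  then show ?thesis using floor_pt_in by (intro exI[of _ K]) auto
qed

lemma set_integrable_floor_pt:
  assumes "rdc b \<phi>"
  shows "set_integrable lborel {a..b} (\<lambda>x. \<phi> (floor_pt x))"
proof -
  obtain K where K: "K > 0" "\<And>x. x \<in> {a..b} \<Longrightarrow> \<bar>\<phi> (floor_pt x)\<bar> \<le> K"
    using rdc_bounded_floor_pt[OF assms] by blast
  show ?thesis
  proof (rule set_integrable_bound[of _ _ "\<lambda>_. K"])
    show "set_integrable lborel {a..b} (\<lambda>_. K)"
      by (intro borel_integrable_atLeastAtMost') auto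
    show "set_borel_measurable lborel {a..b} (\<lambda>x. \<phi> (floor_pt x))"
      using measurable_floor_pt[OF assms] borel_measurable_restrict_space_iff[of "{a..b}" borel "\<lambda>x. \<phi> (floor_pt x)"]
      by (simp add: set_borel_measurable_def)
    show "AE x in lborel. x \<in> {a..b} \<longrightarrow> norm (\<phi> (floor_pt x)) \<le> norm K"
      using K by (auto intro!: AE_I2)
  qed
qed

lemma integrable_floor_pt:
  "rdc b \<phi> \<Longrightarrow> (\<lambda>x. \<phi> (floor_pt x)) integrable_on {a..b}"
  using set_borel_integral_eq_integral(1)[OF set_integrable_floor_pt] .

text \<open>One estimate serves every case of the delta derivative: \<open>e\<close> is small near a
  right-dense point, 0 across a gap, and a crude bound to the left of a right-scattered point. The
  end \<open>t\<close> is left out of the hypothesis since a single point does not influence the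
  integral.\<close>

lemma integral_floor_pt_approx:
  assumes \<phi>: "rdc b \<phi>" and st: "a \<le> s" "s \<le> t" "t \<le> b"
    and le: "\<And>x. s \<le> x \<Longrightarrow> x < t \<Longrightarrow> \<bar>\<phi> (floor_pt x) - c\<bar> \<le> e"
  shows "\<bar>integral {a..t} (\<lambda>x. \<phi> (floor_pt x)) - integral {a..s} (\<lambda>x. \<phi> (floor_pt x)) - c * (t - s)\<bar>
    \<le> e * (t - s)"
proof (cases "s = t")
  case False
  have int: "(\<lambda>x. \<phi> (floor_pt x)) integrable_on {u..v}" if "a \<le> u" "v \<le> b" for u v
    using integrable_subinterval_real[OF integrable_floor_pt[OF \<phi>], of u v] that by auto
  have "integral {a..t} (\<lambda>x. \<phi> (floor_pt x)) - integral {a..s} (\<lambda>x. \<phi> (floor_pt x))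
      = integral {s..t} (\<lambda>x. \<phi> (floor_pt x))"
    using Henstock_Kurzweil_Integration.integral_combine[OF st(1,2) int[of a t]] st by simp
  moreover have "((\<lambda>x. \<phi> (floor_pt x) - c) has_integral
      (integral {s..t} (\<lambda>x. \<phi> (floor_pt x)) - c * (t - s))) {s..t}"
    using has_integral_diff[OF integrable_integral[OF int[of s t]] has_integral_const_real[of c s t]] st
    by (simp add: mult.commute)
  then have "norm (integral {s..t} (\<lambda>x. \<phi> (floor_pt x)) - c * (t - s)) \<le> e * measure lborel {s..t}"
  proof (rule has_integral_bound_real[of _ "{t}", rotated 2])
    have "\<bar>\<phi> (floor_pt s) - c\<bar> \<le> e" using le[of s] st False by auto
    then show "0 \<le> e" by simp
    show "norm (\<phi> (floor_pt x) - c) \<le> e" if "x \<in> {s..t} - {t}" for x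
      using le[of x] that by auto
  qed simp
  ultimately show ?thesis using st by simp
qed auto

text \<open>The only possible exceptional point is \<open>b\<close>, where
  \<open>rdc b \<phi>\<close> leaves the value of \<open>\<phi>\<close> open; it counts as
  right-dense because \<open>fwd_jump S b = b\<close>.\<close>

lemma pre_antiderivative_floor_pt:
  assumes \<phi>: "rdc b \<phi>"
  shows "pre_antiderivative S \<phi> (\<lambda>t. integral {a..t} (\<lambda>x. \<phi> (floor_pt x)))" (is "pre_antiderivative _ _ ?F")
  unfolding pre_antiderivative_def
proof (intro conjI exI[of _ "S \<inter> {..<b}"])
  obtain K where K: "K > 0" "\<And>x. x \<in> {a..b} \<Longrightarrow> \<bar>\<phi> (floor_pt x)\<bar> \<le> K"
    using rdc_bounded_floor_pt[OF \<phi>] by blast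
  have kap: "ts_kappa S = S \<inter> {..bwd_jump S b}"
    using closed_S b_in S_bounds by (intro ts_kappa_eq) auto
  note bj = bwd_jump_max[OF closed_S b_in]
  show "continuous_on S ?F"
    using indefinite_integral_continuous_1[OF integrable_floor_pt[OF \<phi>]] S_bounds
    by (rule continuous_on_subset)
  show "S \<inter> {..<b} \<subseteq> ts_kappa S" using bj by (auto simp: kap)
  have sub: "ts_kappa S - S \<inter> {..<b} \<subseteq> {b}" using le_b by (force simp: kap)
  show "countable (ts_kappa S - S \<inter> {..<b})" using sub by (rule countable_subset) auto
  show "\<forall>t\<in>ts_kappa S - S \<inter> {..<b}. fwd_jump S t = t" using sub fwd_jump_eq_b by auto
  show "\<forall>t\<in>S \<inter> {..<b}. has_delta_derivative S ?F (\<phi> t) t"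
  proof
    fix t assume "t \<in> S \<inter> {..<b}"
    then have t: "t \<in> S" "t < b" "a \<le> t" using a_le by auto
    note fj = fwd_jump_props[OF closed_S t(1) b_in t(2)]
    let ?\<sigma> = "fwd_jump S t"
    show "has_delta_derivative S ?F (\<phi> t) t"
      unfolding has_delta_derivative_def
    proof (intro allI impI)
      fix \<epsilon> :: real assume \<epsilon>: "\<epsilon> > 0"
      show "\<exists>r>0. \<forall>s\<in>S. \<bar>s - t\<bar> < r \<longrightarrow> \<bar>?F ?\<sigma> - ?F s - \<phi> t * (?\<sigma> - s)\<bar> \<le> \<epsilon> * \<bar>?\<sigma> - s\<bar>"
      proof (cases "?\<sigma> = t")
        case True
        have "continuous (at t within S \<inter> {..<b}) \<phi>" using \<phi> t True by (auto simp: rdc_def)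
        then obtain r0 where r0: "r0 > 0"
          "\<forall>s\<in>S \<inter> {..<b}. \<bar>s - t\<bar> < r0 \<longrightarrow> \<bar>\<phi> s - \<phi> t\<bar> < \<epsilon>"
          using \<epsilon> unfolding continuous_within_eps_delta dist_real_def by meson
        \<comment> \<open>The second bound keeps \<open>s\<close> below \<open>b\<close>, where the
          continuity of \<open>\<phi>\<close> is available.\<close>
        define r where "r = min r0 (b - t)"
        have r_pos: "r > 0" using r0 t by (simp add: r_def)
        have r: "\<bar>\<phi> s - \<phi> t\<bar> \<le> \<epsilon>" if "s \<in> S" "\<bar>s - t\<bar> < r" for s
        proof -
          have "s < b" "\<bar>s - t\<bar> < r0" using that by (auto simp: r_def)
          then show ?thesis using r0(2) that(1) by force
        qed
        show ?thesis
        proof (intro exI[of _ r] conjI ballI impI)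
          fix s assume s: "s \<in> S" "\<bar>s - t\<bar> < r"
          show "\<bar>?F ?\<sigma> - ?F s - \<phi> t * (?\<sigma> - s)\<bar> \<le> \<epsilon> * \<bar>?\<sigma> - s\<bar>"
          proof (cases "s \<le> t")
            case le: True
            have "\<bar>?F t - ?F s - \<phi> t * (t - s)\<bar> \<le> \<epsilon> * (t - s)"
            proof (rule integral_floor_pt_approx[OF \<phi>])
              fix x assume x: "s \<le> x" "x < t"
              then show "\<bar>\<phi> (floor_pt x) - \<phi> t\<bar> \<le> \<epsilon>"
                using floor_pt_in[of x] floor_pt_le[of x] le_floor_pt[of s x] s a_le[of s] by (intro r) auto
            qed (use s t le a_le in auto)
            then show ?thesis using True le by simp
          next
            case False
            have "\<bar>?F s - ?F t - \<phi> t * (s - t)\<bar> \<le> \<epsilon> * (s - t)"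
            proof (rule integral_floor_pt_approx[OF \<phi>])
              fix x assume x: "t \<le> x" "x < s"
              then show "\<bar>\<phi> (floor_pt x) - \<phi> t\<bar> \<le> \<epsilon>"
                using floor_pt_in[of x] floor_pt_le[of x] le_floor_pt[of t x] s t by (intro r) auto
            qed (use s t le_b False in auto)
            then show ?thesis using True False by (simp add: right_diff_distrib abs_minus_commute algebra_simps)
          qed
        qed (rule r_pos)
      next
        case False
        then have \<sigma>: "t < ?\<sigma>" using fj(2) by simp
        have step: "?F ?\<sigma> - ?F t = \<phi> t * (?\<sigma> - t)"
        proof -
          have "\<bar>?F ?\<sigma> - ?F t - \<phi> t * (?\<sigma> - t)\<bar> \<le> 0 * (?\<sigma> - t)"
          proof (rule integral_floor_pt_approx[OF \<phi>])
            fix x assume x: "t \<le> x" "x < ?\<sigma>"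
            have "floor_pt x = t"
            proof (rule antisym)
              show "floor_pt x \<le> t"
                using fj(3)[of "floor_pt x"] floor_pt_in[of x] floor_pt_le[of x] x t by force
              show "t \<le> floor_pt x" using x t by (intro le_floor_pt)
            qed
            then show "\<bar>\<phi> (floor_pt x) - \<phi> t\<bar> \<le> 0" by simp
          qed (use t \<sigma> fj(1) le_b in auto)
          then show ?thesis by simp
        qed
        \<comment> \<open>The first bound excludes points beyond \<open>t\<close>. To the left of
          \<open>t\<close> the function \<open>\<phi>\<close> may oscillate by \<open>2 * K\<close>,
          but the error is measured against the gap length, so it suffices that \<open>t - s\<close>
          is small compared with the gap.\<close>
        define r where "r = min (?\<sigma> - t) (\<epsilon> * (?\<sigma> - t) / (2 * K))"
        show ?thesis
        proof (intro exI[of _ r] conjI ballI impI)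
          show "r > 0" using \<sigma> \<epsilon> K by (auto simp: r_def)
          fix s assume s: "s \<in> S" "\<bar>s - t\<bar> < r"
          have "s \<le> t" using fj(3)[of s] s by (force simp: r_def)
          have "\<bar>?F t - ?F s - \<phi> t * (t - s)\<bar> \<le> (2 * K) * (t - s)"
          proof (rule integral_floor_pt_approx[OF \<phi>])
            fix x assume x: "s \<le> x" "x < t"
            show "\<bar>\<phi> (floor_pt x) - \<phi> t\<bar> \<le> 2 * K"
              using K(2)[of x] K(2)[of t] x t floor_pt_id[OF t(1)] a_le[OF s(1)] by auto
          qed (use s t \<open>s \<le> t\<close> a_le in auto)
          also have "\<dots> \<le> \<epsilon> * (?\<sigma> - t)"
          proof -
            have "t - s \<le> \<epsilon> * (?\<sigma> - t) / (2 * K)" using s \<open>s \<le> t\<close> by (auto simp: r_def)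
            then show ?thesis using K(1) by (simp add: field_simps)
          qed
          also have "\<dots> \<le> \<epsilon> * \<bar>?\<sigma> - s\<bar>" using \<epsilon> \<open>s \<le> t\<close> \<sigma> by auto
          finally show "\<bar>?F ?\<sigma> - ?F s - \<phi> t * (?\<sigma> - s)\<bar> \<le> \<epsilon> * \<bar>?\<sigma> - s\<bar>"
            using step by (simp add: algebra_simps)
        qed
      qed
    qed
  qed
qed


section \<open>Closure properties of the class \<open>rdc\<close>\<close>

lemma compact_S: "compact S"
  using closed_S S_bounds compact_Icc by (metis compact_Int_closed inf.absorb_iff2)

lemma rdc_antimono: "rdc e \<phi> \<Longrightarrow> e' \<le> e \<Longrightarrow> rdc e' \<phi>"
  unfolding rdc_def
  by (auto elim!: bounded_subset intro!: continuous_within_subset[of _ "S \<inter> {..<e}" _ "S \<inter> {..<e'}"])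

lemma rdc_cong:
  assumes "\<And>s. s \<in> S \<Longrightarrow> s < e \<Longrightarrow> \<phi> s = \<psi> s"
  shows "rdc e \<phi> \<longleftrightarrow> rdc e \<psi>"
proof -
  have "rdc e \<psi>'" if "rdc e \<phi>'" "\<And>s. s \<in> S \<Longrightarrow> s < e \<Longrightarrow> \<phi>' s = \<psi>' s" for \<phi>' \<psi>'
    unfolding rdc_def
  proof (intro conjI ballI impI)
    have "\<psi>' ` (S \<inter> {..<e}) = \<phi>' ` (S \<inter> {..<e})" using that(2) by (intro image_cong) auto
    then show "bounded (\<psi>' ` (S \<inter> {..<e}))" using that(1) by (simp add: rdc_def)
    fix t assume t: "t \<in> S \<inter> {..<e}" "fwd_jump S t = t"
    then have "continuous (at t within S \<inter> {..<e}) \<phi>'" using that(1) by (auto simp: rdc_def)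
    then show "continuous (at t within S \<inter> {..<e}) \<psi>'"
      by (rule continuous_transform_within[of _ _ _ 1]) (use t that(2) in auto)
  qed
  from this[of \<phi> \<psi>] this[of \<psi> \<phi>] assms show ?thesis by auto
qed

lemma rdc_const: "rdc e (\<lambda>_. c)"
  by (auto simp: rdc_def bounded_iff)

lemma rdc_add: "rdc e \<phi> \<Longrightarrow> rdc e \<psi> \<Longrightarrow> rdc e (\<lambda>s. \<phi> s + \<psi> s)"
  unfolding rdc_def by (auto intro!: bounded_plus_comp continuous_intros)

lemma rdc_mult:
  assumes "rdc e \<phi>" "rdc e \<psi>"
  shows "rdc e (\<lambda>s. \<phi> s * \<psi> s)"
proof -
  obtain A B where AB: "\<And>s. s \<in> S \<inter> {..<e} \<Longrightarrow> \<bar>\<phi> s\<bar> \<le> A" "\<And>s. s \<in> S \<inter> {..<e} \<Longrightarrow> \<bar>\<psi> s\<bar> \<le> B"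
    using assms unfolding rdc_def bounded_iff by (metis imageI real_norm_def)
  have "\<bar>\<phi> s * \<psi> s\<bar> \<le> A * B" if "s \<in> S \<inter> {..<e}" for s
    unfolding abs_mult using AB[OF that] by (intro mult_mono) auto
  then have "bounded ((\<lambda>s. \<phi> s * \<psi> s) ` (S \<inter> {..<e}))"
    by (auto simp: bounded_iff)
  then show ?thesis using assms by (auto simp: rdc_def intro!: continuous_intros)
qed

text \<open>The closure of the bounded range of \<open>\<phi>\<close> is compact and, as
  \<open>C\<close> is closed, stays inside \<open>C\<close>; hence \<open>g\<close> is bounded on
  it.\<close>

lemma rdc_compose:
  assumes \<phi>: "rdc e \<phi>" and g: "continuous_on C g" "closed C" "\<And>s. s \<in> S \<Longrightarrow> s < e \<Longrightarrow> \<phi> s \<in> C"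
  shows "rdc e (\<lambda>s. g (\<phi> s))"
  unfolding rdc_def
proof (intro conjI ballI impI)
  let ?X = "S \<inter> {..<e}"
  have sub: "closure (\<phi> ` ?X) \<subseteq> C" using g by (intro closure_minimal) auto
  have "compact (closure (\<phi> ` ?X))" using \<phi> by (simp add: rdc_def compact_closure)
  then have "compact (g ` closure (\<phi> ` ?X))"
    by (intro compact_continuous_image continuous_on_subset[OF g(1) sub])
  then have "bounded (g ` closure (\<phi> ` ?X))" by (rule compact_imp_bounded)
  then show "bounded ((\<lambda>s. g (\<phi> s)) ` ?X)"
    by (rule bounded_subset) (intro image_mono image_subsetI, use closure_subset[of "\<phi> ` ?X"] in blast)
  fix t assume t: "t \<in> ?X" "fwd_jump S t = t"
  have "continuous_on (\<phi> ` ?X) g" using g by (intro continuous_on_subset[OF g(1)]) auto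
  then have "continuous (at (\<phi> t) within \<phi> ` ?X) g" using t by (auto simp: continuous_on_eq_continuous_within)
  moreover have "continuous (at t within ?X) \<phi>" using \<phi> t by (auto simp: rdc_def)
  ultimately show "continuous (at t within ?X) (\<lambda>s. g (\<phi> s))"
    using continuous_within_compose[of t ?X \<phi> g] by (simp add: o_def)
qed

text \<open>Separate bounds \<open>e\<close> and \<open>e'\<close> allow \<open>e\<close> to lie
  beyond \<open>e'\<close> when only a gap of \<open>S\<close> separates them. A function known up
  to the backward jump of \<open>t\<close> is thus regular enough for integration up to
  \<open>t\<close>.\<close>

lemma rdc_continuous_on:
  assumes \<phi>: "continuous_on (S \<inter> {..e'}) \<phi>" and sub: "S \<inter> {..<e} \<subseteq> {..e'}"
  shows "rdc e \<phi>"
  unfolding rdc_def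
proof (intro conjI ballI impI)
  have "compact (S \<inter> {..e'})" using compact_S by (intro compact_Int_closed) auto
  then have "bounded (\<phi> ` (S \<inter> {..e'}))"
    using \<phi> by (intro compact_imp_bounded compact_continuous_image)
  then show "bounded (\<phi> ` (S \<inter> {..<e}))" by (rule bounded_subset) (use sub in auto)
  fix t assume "t \<in> S \<inter> {..<e}"
  then have "continuous (at t within S \<inter> {..e'}) \<phi>"
    using \<phi> sub by (auto simp: continuous_on_eq_continuous_within)
  then show "continuous (at t within S \<inter> {..<e}) \<phi>"
    by (rule continuous_within_subset) (use sub in auto)
qed

text \<open>Only boundedness takes work. Near each point of \<open>D\<close> the function is bounded
  on the right by continuity or because of a gap, on the left by the finite limit or because of a
  gap; compactness of \<open>D\<close> makes this global.\<close>

lemma rd_continuous_on_imp_rdc: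
  assumes \<phi>: "rd_continuous_on S D \<phi>" and D: "closed D" "D \<subseteq> S" "S \<inter> {..<b} \<subseteq> D"
  shows "rdc b \<phi>"
  unfolding rdc_def
proof (intro conjI ballI impI)
  have loc: "\<exists>r>0. bounded (\<phi> ` (D \<inter> ball t r))" if t: "t \<in> D" for t
  proof -
    have right: "\<exists>r>0. \<exists>K. \<forall>s\<in>D. t \<le> s \<longrightarrow> s < t + r \<longrightarrow> \<bar>\<phi> s\<bar> \<le> K"
    proof (cases "fwd_jump S t = t")
      case True
      then have "continuous (at t within D) \<phi>" using \<phi> t by (auto simp: rd_continuous_on_def)
      then obtain r where r: "r > 0" "\<forall>s\<in>D. \<bar>s - t\<bar> < r \<longrightarrow> \<bar>\<phi> s - \<phi> t\<bar> < 1"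
        unfolding continuous_within_eps_delta dist_real_def using zero_less_one by blast
      have "\<bar>\<phi> s\<bar> \<le> \<bar>\<phi> t\<bar> + 1" if "s \<in> D" "t \<le> s" "s < t + r" for s
        using r(2)[rule_format, of s] that by auto
      then show ?thesis using r(1) by blast
    next
      case False
      then have tb: "t < b" using fwd_jump_eq_b le_b[of t] t D by (cases "t = b") auto
      have tS: "t \<in> S" using t D by auto
      note fj = fwd_jump_props[OF closed_S tS b_in tb]
      have "\<bar>\<phi> s\<bar> \<le> \<bar>\<phi> t\<bar>" if "s \<in> D" "t \<le> s" "s < t + (fwd_jump S t - t)" for s
        using fj(3)[of s] that D by (cases "s = t") auto
      moreover have "fwd_jump S t - t > 0" using fj(2) False by simp
      ultimately show ?thesis by blast
    qed
    have left: "\<exists>r>0. \<exists>K. \<forall>s\<in>D. s < t \<longrightarrow> t - r < s \<longrightarrow> \<bar>\<phi> s\<bar> \<le> K"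
    proof (cases "bwd_jump S t = t")
      case True
      then obtain l where "(\<phi> \<longlongrightarrow> l) (at t within (D \<inter> {..<t}))"
        using \<phi> t by (auto simp: rd_continuous_on_def)
      then obtain r where r: "r > 0" "\<forall>s\<in>D \<inter> {..<t}. 0 < \<bar>s - t\<bar> \<and> \<bar>s - t\<bar> < r \<longrightarrow> \<bar>\<phi> s - l\<bar> < 1"
        unfolding Lim_within dist_real_def using zero_less_one by blast
      have "\<bar>\<phi> s\<bar> \<le> \<bar>l\<bar> + 1" if "s \<in> D" "s < t" "t - r < s" for s
        using r(2)[rule_format, of s] that by auto
      then show ?thesis using r(1) by blast
    next
      case False
      have tS: "t \<in> S" using t D by auto
      note bj = bwd_jump_max[OF closed_S tS]
      \<comment> \<open>Vacuously true: no such \<open>s\<close> lies in the gap to the left of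
        \<open>t\<close>.\<close>
      have "\<bar>\<phi> s\<bar> \<le> 0" if "s \<in> D" "s < t" "t - (t - bwd_jump S t) < s" for s
        using bj(3)[of s] that D by auto
      moreover have "t - bwd_jump S t > 0" using bj(2) False by simp
      ultimately show ?thesis by blast
    qed
    obtain r K r' K' where *: "r > 0" "\<forall>s\<in>D. t \<le> s \<longrightarrow> s < t + r \<longrightarrow> \<bar>\<phi> s\<bar> \<le> K"
      "r' > 0" "\<forall>s\<in>D. s < t \<longrightarrow> t - r' < s \<longrightarrow> \<bar>\<phi> s\<bar> \<le> K'"
      using left right by blast
    have "\<bar>\<phi> s\<bar> \<le> max K K'" if "s \<in> D" "s \<in> ball t (min r r')" for s
    proof (cases "t \<le> s")
      case True
      then show ?thesis using *(2)[rule_format, of s] that by (auto simp: dist_real_def)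
    next
      case False
      then show ?thesis using *(4)[rule_format, of s] that by (auto simp: dist_real_def)
    qed
    then have "bounded (\<phi> ` (D \<inter> ball t (min r r')))"
      unfolding bounded_iff by (intro exI[of _ "max K K'"]) auto
    then show ?thesis using *(1,3) by (intro exI[of _ "min r r'"]) auto
  qed
  then obtain r where r: "\<And>t. t \<in> D \<Longrightarrow> r t > 0" "\<And>t. t \<in> D \<Longrightarrow> bounded (\<phi> ` (D \<inter> ball t (r t)))"
    by metis
  have "compact D" using compact_S D by (metis compact_Int_closed inf.absorb_iff2)
  then obtain N where N: "N \<subseteq> D" "finite N" "D \<subseteq> (\<Union>t\<in>N. ball t (r t))"
    by (rule compactE_image[of D D "\<lambda>t. ball t (r t)"]) (use r(1) in auto)
  have "bounded (\<Union>t\<in>N. \<phi> ` (D \<inter> ball t (r t)))" 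
    using N(1,2) by (intro bounded_UN ballI r(2)) auto
  moreover have "\<phi> ` (S \<inter> {..<b}) \<subseteq> (\<Union>t\<in>N. \<phi> ` (D \<inter> ball t (r t)))"
  proof (rule image_subsetI)
    fix s assume "s \<in> S \<inter> {..<b}"
    then have "s \<in> D" using D(3) by blast
    then obtain t where "t \<in> N" "s \<in> ball t (r t)" using N(3) by blast
    then show "\<phi> s \<in> (\<Union>t\<in>N. \<phi> ` (D \<inter> ball t (r t)))" using \<open>s \<in> D\<close> by blast
  qed
  ultimately show "bounded (\<phi> ` (S \<inter> {..<b}))" by (rule bounded_subset)
  fix t assume "t \<in> S \<inter> {..<b}" "fwd_jump S t = t"
  then have "continuous (at t within D) \<phi>" using \<phi> D by (auto simp: rd_continuous_on_def)
  then show "continuous (at t within S \<inter> {..<b}) \<phi>" by (rule continuous_within_subset[OF _ D(3)])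
qed

section \<open>Restriction of the time scale to the points up to \<open>e\<close>\<close>

context
  fixes e assumes e: "e \<in> S"
begin

interpretation sub: compact_time_scale "ts_Icc S a e" a e
proof
  have "ts_Icc S a e = S \<inter> {a..e}" by (auto simp: ts_Icc_def)
  then show "closed (ts_Icc S a e)" using closed_S by (auto intro: closed_Int)
qed (use e a_in a_le in \<open>auto simp: ts_Icc_def\<close>)

lemma sub_floor_pt: "x \<le> e \<Longrightarrow> sub.floor_pt x = floor_pt x"
proof -
  assume "x \<le> e"
  then have "{s \<in> ts_Icc S a e. s \<le> x} = {s \<in> S. s \<le> x}" using a_le by (auto simp: ts_Icc_def)
  then show ?thesis by (simp add: floor_pt_def sub.floor_pt_def)
qed

text \<open>Below \<open>e\<close> a point that is right-dense in the subinterval is right-dense in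
  \<open>S\<close>. At \<open>e\<close> this may fail, since the maximum of the subinterval counts
  as right-dense; \<open>rdc e\<close> does not look at \<open>e\<close>.\<close>

lemma sub_rdc:
  assumes "rdc e \<phi>"
  shows "sub.rdc e \<phi>"
proof -
  have X: "ts_Icc S a e \<inter> {..<e} = S \<inter> {..<e}" using a_le by (auto simp: ts_Icc_def)
  have "fwd_jump S t = t" if t: "t \<in> S" "t < e" and fw: "fwd_jump (ts_Icc S a e) t = t" for t
  proof (rule ccontr)
    assume "fwd_jump S t \<noteq> t"
    moreover have tb: "t < b" using t e le_b by fastforce
    note fj = fwd_jump_props[OF closed_S t(1) b_in tb]
    ultimately have "fwd_jump S t - t > 0" using fj(2) by simp
    moreover have "t \<in> ts_Icc S a e" using t a_le by (auto simp: ts_Icc_def)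
    ultimately obtain s where "s \<in> ts_Icc S a e" "t < s" "s < t + (fwd_jump S t - t)"
      using fwd_jump_dense[OF sub.closed_S _ sub.b_in t(2) fw] by blast
    then show False using fj(3)[of s] by (auto simp: ts_Icc_def)
  qed
  then show ?thesis
    using assms unfolding sub.rdc_def rdc_def X by auto
qed

text \<open>Here \<open>floor_pt\<close> belongs to all of \<open>S\<close>, so that one extension
  of the integrand serves every upper limit \<open>e\<close>.\<close>

lemma delta_integral_eq:
  assumes \<phi>: "rdc e \<phi>"
  shows "delta_integral S a e \<phi> = integral {a..e} (\<lambda>x. \<phi> (floor_pt x))"
    and "(\<lambda>x. \<phi> (floor_pt x)) integrable_on {a..e}"
proof -
  have eq: "\<phi> (sub.floor_pt x) = \<phi> (floor_pt x)" if "x \<in> {a..e}" for x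
    using that sub_floor_pt[of x] by simp
  show "(\<lambda>x. \<phi> (floor_pt x)) integrable_on {a..e}"
    using sub.integrable_floor_pt[OF sub_rdc[OF \<phi>]] integrable_cong[of "{a..e}", OF eq] by simp
  define F where "F t = integral {a..t} (\<lambda>x. \<phi> (sub.floor_pt x))" for t
  have F: "pre_antiderivative (ts_Icc S a e) \<phi> F"
    unfolding F_def by (rule sub.pre_antiderivative_floor_pt[OF sub_rdc[OF \<phi>]])
  have "delta_integral S a e \<phi> = F e - F a"
    unfolding delta_integral_def
  proof (rule the_equality)
    show "I = F e - F a" if "\<exists>F. pre_antiderivative (ts_Icc S a e) \<phi> F \<and> I = F e - F a" for I
      using that F pre_antiderivative_unique[OF sub.closed_S sub.S_bounds sub.a_in sub.b_in] by blast
  qed (use F in blast)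
  also have "\<dots> = integral {a..e} (\<lambda>x. \<phi> (floor_pt x))"
    using Henstock_Kurzweil_Integration.integral_cong[of "{a..e}", OF eq] by (simp add: F_def)
  finally show "delta_integral S a e \<phi> = integral {a..e} (\<lambda>x. \<phi> (floor_pt x))" .
qed

end

section \<open>Calculus of delta integrals with lower limit \<open>a\<close>\<close>

abbreviation dint :: "real \<Rightarrow> (real \<Rightarrow> real) \<Rightarrow> real" where
  "dint \<equiv> delta_integral S a"

text \<open>The integrand is cut off at \<open>e\<close> because an rd-continuous integrand is arbitrary there.\<close>

lemma has_integral_dint:
  assumes "e \<in> S" "rdc e \<phi>"
  shows "((\<lambda>x. if x < e then \<phi> (floor_pt x) else 0) has_integral dint e \<phi>) {a..e}"
proof (rule has_integral_spike_finite[of "{e}"])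
  show "((\<lambda>x. \<phi> (floor_pt x)) has_integral dint e \<phi>) {a..e}"
    using delta_integral_eq[OF assms] by (simp add: has_integral_integral)
qed auto

lemma floor_pt_less: "x \<in> {a..e} \<Longrightarrow> x < e \<Longrightarrow> floor_pt x \<in> S \<and> floor_pt x < e"
  using floor_pt_in[of x] floor_pt_le[of x] by auto

lemma dint_mono:
  assumes "e \<in> S" "rdc e \<phi>" "rdc e \<psi>" "\<And>s. s \<in> S \<Longrightarrow> s < e \<Longrightarrow> \<phi> s \<le> \<psi> s"
  shows "dint e \<phi> \<le> dint e \<psi>"
  by (rule has_integral_le[OF has_integral_dint[OF assms(1,2)] has_integral_dint[OF assms(1,3)]])
    (use assms(4) floor_pt_less in auto)

lemma dint_unique:
  assumes "e \<in> S" "rdc e \<phi>" "((\<lambda>x. if x < e then \<phi> (floor_pt x) else 0) has_integral c) {a..e}"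
  shows "dint e \<phi> = c"
  using has_integral_unique[OF has_integral_dint[OF assms(1,2)] assms(3)] .

lemma dint_zero: "e \<in> S \<Longrightarrow> dint e (\<lambda>_. 0) = 0"
  by (rule dint_unique) (auto simp: rdc_const)

lemma dint_nonneg:
  assumes "e \<in> S" "rdc e \<phi>" "\<And>s. s \<in> S \<Longrightarrow> s < e \<Longrightarrow> 0 \<le> \<phi> s"
  shows "0 \<le> dint e \<phi>"
  using dint_mono[OF assms(1) rdc_const assms(2), of 0] assms dint_zero by simp

lemma dint_add:
  assumes "e \<in> S" "rdc e \<phi>" "rdc e \<psi>"
  shows "dint e (\<lambda>s. \<phi> s + \<psi> s) = dint e \<phi> + dint e \<psi>"
proof (rule dint_unique[OF assms(1) rdc_add[OF assms(2,3)]])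
  show "((\<lambda>x. if x < e then \<phi> (floor_pt x) + \<psi> (floor_pt x) else 0) has_integral dint e \<phi> + dint e \<psi>) {a..e}"
    using has_integral_add[OF has_integral_dint[OF assms(1,2)] has_integral_dint[OF assms(1,3)]]
    by (rule has_integral_eq[rotated]) auto
qed

lemma dint_cmult:
  assumes "e \<in> S" "rdc e \<phi>"
  shows "dint e (\<lambda>s. c * \<phi> s) = c * dint e \<phi>"
proof (rule dint_unique[OF assms(1) rdc_mult[OF rdc_const assms(2)]])
  show "((\<lambda>x. if x < e then c * \<phi> (floor_pt x) else 0) has_integral c * dint e \<phi>) {a..e}"
    using has_integral_mult_right[OF has_integral_dint[OF assms], of c]
    by (rule has_integral_eq[rotated]) auto
qed

lemma continuous_on_dint:
  assumes "e \<in> S" "rdc e \<phi>"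
  shows "continuous_on (S \<inter> {..e}) (\<lambda>s. dint s \<phi>)"
proof -
  have "continuous_on (S \<inter> {..e}) (\<lambda>s. integral {a..s} (\<lambda>x. \<phi> (floor_pt x)))"
    using indefinite_integral_continuous_1[OF delta_integral_eq(2)[OF assms]]
    by (rule continuous_on_subset) (use a_le in auto)
  then show ?thesis
    by (rule continuous_on_eq) (use assms(2) rdc_antimono delta_integral_eq(1) in auto)
qed

lemma dint_le_dint:
  assumes st: "s \<in> S" "t \<in> S" "s \<le> t" and \<phi>: "rdc t \<phi>" and nn: "\<And>r. r \<in> S \<Longrightarrow> r < t \<Longrightarrow> 0 \<le> \<phi> r"
  shows "dint s \<phi> \<le> dint t \<phi>"
proof -
  let ?f = "\<lambda>x. if x < t then \<phi> (floor_pt x) else 0"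
  have t: "(?f has_integral dint t \<phi>) {a..t}" using has_integral_dint[OF st(2) \<phi>] .
  have "((\<lambda>x. if x < s then \<phi> (floor_pt x) else 0) has_integral dint s \<phi>) {a..s}"
    using has_integral_dint[OF st(1) rdc_antimono[OF \<phi> st(3)]] .
  then have s: "(?f has_integral dint s \<phi>) {a..s}"
    by (rule has_integral_spike_finite[of "{s}", rotated 2]) (use st in auto)
  show ?thesis
  proof (rule has_integral_subset_le[OF _ s t])
    show "{a..s} \<subseteq> {a..t}" using st by simp
    show "\<forall>x\<in>{a..t}. 0 \<le> ?f x" using nn floor_pt_less by auto
  qed
qed

lemma rdc_bdd:
  assumes "rdc e \<phi>"
  shows "\<exists>K. \<forall>s\<in>S. s < e \<longrightarrow> \<bar>\<phi> s\<bar> \<le> K"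
  using assms by (auto simp: rdc_def bounded_iff)

text \<open>The bounded factor squeezes the product between constant multiples of
  \<open>\<phi>\<close>, whose integrals vanish. This settles the degenerate case
  \<open>\<xi> = 0\<close> without a null set argument.\<close>

lemma dint_mult_eq_0:
  assumes e: "e \<in> S" and rdc: "rdc e \<phi>" "rdc e \<psi>" and nn: "\<And>s. s \<in> S \<Longrightarrow> s < e \<Longrightarrow> 0 \<le> \<phi> s"
    and zero: "dint e \<phi> = 0"
  shows "dint e (\<lambda>s. \<phi> s * \<psi> s) = 0"
proof -
  obtain K where K: "\<forall>s\<in>S. s < e \<longrightarrow> \<bar>\<psi> s\<bar> \<le> K" using rdc_bdd[OF rdc(2)] by blast
  have b: "(- K) * \<phi> s \<le> \<phi> s * \<psi> s \<and> \<phi> s * \<psi> s \<le> K * \<phi> s" if "s \<in> S" "s < e" for s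
  proof -
    have "- K \<le> \<psi> s" "\<psi> s \<le> K" using K that by fastforce+
    then show ?thesis
      using mult_right_mono[of "- K" "\<psi> s" "\<phi> s"] mult_right_mono[of "\<psi> s" K "\<phi> s"] nn[OF that]
      by (simp add: mult.commute)
  qed
  have "dint e (\<lambda>s. (- K) * \<phi> s) \<le> dint e (\<lambda>s. \<phi> s * \<psi> s)"
    using b by (intro dint_mono e rdc_mult rdc rdc_const) auto
  moreover have "dint e (\<lambda>s. \<phi> s * \<psi> s) \<le> dint e (\<lambda>s. K * \<phi> s)"
    using b by (intro dint_mono e rdc_mult rdc rdc_const) auto
  ultimately show ?thesis
    unfolding dint_cmult[OF e rdc(1)] using zero by simp
qed

end

section \<open>The Bihari inequality\<close>

text \<open>As \<open>w\<close> is nondecreasing, the integrand lies between its values at the two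
  ends. Strict monotonicity and Lipschitz continuity of \<open>P\<close>, and the growth bound
  required for the Bihari inequality, all come from these two estimates; \<open>P\<close> is never
  differentiated.\<close>

lemma primitive_inverse_bounds:
  fixes w P :: "real \<Rightarrow> real" and x0 x y :: real
  assumes cont: "continuous_on {0<..} w" and mono: "mono_on {0<..} w" and pos: "\<And>x. x > 0 \<Longrightarrow> w x > 0"
    and x0: "x0 > 0" and P: "\<And>x. x > 0 \<Longrightarrow> P x = (LBINT s=x0..x. 1 / w s)"
    and xy: "0 < x" "x \<le> y"
  shows "(y - x) / w y \<le> P y - P x" "P y - P x \<le> (y - x) / w x"
proof -
  have c: "continuous_on {u..v} (\<lambda>s. 1 / w s)" if "u > 0" for u v
  proof -
    have "w s \<noteq> 0" if "s \<in> {u..v}" for s using pos[of s] that \<open>u > 0\<close> by auto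
    then show ?thesis
      using that by (intro continuous_intros continuous_on_subset[OF cont]) auto
  qed
  have intf: "set_integrable lborel {u..v} (\<lambda>s. 1 / w s)" if "u > 0" for u v
    by (rule borel_integrable_atLeastAtMost'[OF c[OF that]])
  have "(LBINT s=x0..x. 1 / w s) + (LBINT s=x..y. 1 / w s) = (LBINT s=x0..y. 1 / w s)"
  proof (rule interval_integral_sum)
    \<comment> \<open>The base point \<open>x0\<close> may lie on either side of \<open>x\<close>
      and \<open>y\<close>, so integrability is needed on the hull of all three.\<close>
    have "interval_lebesgue_integrable lborel (min x0 x) (max x0 y) (\<lambda>s. 1 / w s)"
      using x0 xy by (intro interval_integrable_continuous_on c) auto
    moreover have "min (ereal x0) (min (ereal x) (ereal y)) = ereal (min x0 x)"
      "max (ereal x0) (max (ereal x) (ereal y)) = ereal (max x0 y)"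
      using xy by (simp_all add: min_def max_def)
    ultimately show "interval_lebesgue_integrable lborel (min (ereal x0) (min (ereal x) (ereal y)))
        (max (ereal x0) (max (ereal x) (ereal y))) (\<lambda>s. 1 / w s)"
      by simp
  qed
  then have "P y - P x = (LBINT s=x..y. 1 / w s)" using P xy by simp
  also have "\<dots> = integral {x..y} (\<lambda>s. 1 / w s)"
    by (rule interval_integral_eq_integral[OF xy(2) intf[OF xy(1)]])
  finally have eq: "P y - P x = integral {x..y} (\<lambda>s. 1 / w s)" .
  have int: "(\<lambda>s. 1 / w s) integrable_on {x..y}"
    by (rule integrable_continuous_real[OF c[OF xy(1)]])
  have b: "1 / w y \<le> 1 / w s" "1 / w s \<le> 1 / w x" if "s \<in> {x..y}" for s
  proof -
    have s: "0 < s" "x \<le> s" "s \<le> y" using that xy by auto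
    have "w x \<le> w s" by (rule monotone_onD[OF mono]) (use s xy in simp_all)
    then show "1 / w s \<le> 1 / w x" by (rule divide_left_mono) (use pos s xy in simp_all)
    have "w s \<le> w y" by (rule monotone_onD[OF mono]) (use s xy in simp_all)
    then show "1 / w y \<le> 1 / w s" by (rule divide_left_mono) (use pos s xy in simp_all)
  qed
  have "integral {x..y} (\<lambda>s. 1 / w y) \<le> integral {x..y} (\<lambda>s. 1 / w s)"
    using int b by (intro integral_le) auto
  then show "(y - x) / w y \<le> P y - P x" using eq xy by simp
  have "integral {x..y} (\<lambda>s. 1 / w s) \<le> integral {x..y} (\<lambda>s. 1 / w x)"
    using int b by (intro integral_le) auto
  then show "P y - P x \<le> (y - x) / w x" using eq xy by simp
qed

text \<open>With \<open>k\<close> and \<open>m\<close> merely integrable, \<open>Z\<close> need not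
  be differentiable. On a short interval \<open>w (Z x)\<close> is nearly constant, so the increment
  of \<open>P (Z x)\<close> is at most \<open>1 + \<eta>\<close> times that of \<open>K\<close>.
  Such an inequality adds up over adjacent intervals, hence holds on the whole interval by
  bisection, and \<eta> tends to 0.\<close>

lemma bihari_real:
  fixes k m w P :: "real \<Rightarrow> real"
  assumes "a \<le> e" "c > 0"
    and w: "continuous_on {0<..} w" "mono_on {0<..} w" "\<And>x. x > 0 \<Longrightarrow> w x > 0"
    and P: "\<And>x y. 0 < x \<Longrightarrow> x \<le> y \<Longrightarrow> P y - P x \<le> (y - x) / w x"
    and int: "k integrable_on {a..e}" "m integrable_on {a..e}"
    and k: "\<And>x. x \<in> {a..e} \<Longrightarrow> 0 \<le> k x"
    and m: "\<And>x. x \<in> {a..e} \<Longrightarrow> 0 \<le> m x"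
      "\<And>x. x \<in> {a..e} \<Longrightarrow> m x \<le> k x * w (c + integral {a..x} m)"
  shows "P (c + integral {a..e} m) \<le> P c + integral {a..e} k"
proof -
  define Z where "Z x = c + integral {a..x} m" for x
  define K where "K x = integral {a..x} k" for x
  have sub: "k integrable_on {s..t}" "m integrable_on {s..t}" if "a \<le> s" "t \<le> e" for s t
    using integrable_subinterval_real[OF int(1), of s t] integrable_subinterval_real[OF int(2), of s t] that
    by auto
  have Zd: "Z t - Z s = integral {s..t} m" and Kd: "K t - K s = integral {s..t} k"
    if "a \<le> s" "s \<le> t" "t \<le> e" for s t
    using Henstock_Kurzweil_Integration.integral_combine[OF that(1,2) sub(1)[of a t]]
      Henstock_Kurzweil_Integration.integral_combine[OF that(1,2) sub(2)[of a t]] that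
    by (auto simp: Z_def K_def)
  have Zmono: "Z s \<le> Z t" and Kmono: "K s \<le> K t" if "a \<le> s" "s \<le> t" "t \<le> e" for s t
  proof -
    have "0 \<le> integral {s..t} m" "0 \<le> integral {s..t} k"
      using that k m(1) by (auto intro!: integral_nonneg sub)
    then show "Z s \<le> Z t" "K s \<le> K t" using Zd[OF that] Kd[OF that] by auto
  qed
  have Za: "Z a = c" and Ka: "K a = 0" by (auto simp: Z_def K_def)
  have Zpos: "Z s > 0" if "a \<le> s" "s \<le> e" for s
    using Zmono[of a s] that Za \<open>c > 0\<close> by simp
  have cZ: "continuous_on {a..e} Z"
    unfolding Z_def by (intro continuous_intros indefinite_integral_continuous_1 int)
  have cwZ: "continuous_on {a..e} (\<lambda>x. w (Z x))"
    by (rule continuous_on_compose2[OF w(1) cZ]) (use Zpos in auto)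
  have key: "P (Z e) - P (Z a) \<le> (1 + \<eta>) * (K e - K a)" if "\<eta> > 0" for \<eta>
  proof -
    \<comment> \<open>The bounds are premises inside \<open>Q\<close> because the local step of
      \<open>Bolzano\<close> also meets intervals that reach beyond \<open>a\<close> or
      \<open>e\<close>.\<close>
    define Q where "Q s t \<longleftrightarrow> (a \<le> s \<and> t \<le> e \<longrightarrow> P (Z t) - P (Z s) \<le> (1 + \<eta>) * (K t - K s))" for s t
    have "Q a e"
      using \<open>a \<le> e\<close>
    proof (induction rule: Bolzano)
      case (trans s t r)
      then show ?case by (auto simp: Q_def algebra_simps)
    next
      case (local x)
      \<comment> \<open>This solves
        \<open>w (Z x) + \<rho> = (1 + \<eta>) * (w (Z x) - \<rho>)\<close>: two values within
        \<open>\<rho>\<close> of \<open>w (Z x)\<close> differ at most by the factor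
        \<open>1 + \<eta>\<close>.\<close>
      define \<rho> where "\<rho> = \<eta> * w (Z x) / (2 + \<eta>)"
      have wx: "w (Z x) > 0" using local Zpos w(3) by auto
      then have "\<rho> > 0" using \<open>\<eta> > 0\<close> by (simp add: \<rho>_def)
      then obtain d where d: "d > 0"
        "\<forall>y\<in>{a..e}. \<bar>y - x\<bar> < d \<longrightarrow> \<bar>w (Z y) - w (Z x)\<bar> < \<rho>"
        using cwZ local unfolding continuous_on_iff dist_real_def by (metis atLeastAtMost_iff)
      show ?case
        unfolding Q_def
      proof (intro exI[of _ d] conjI allI impI)
        fix s t assume st: "s \<le> x \<and> x \<le> t \<and> t - s < d" "a \<le> s \<and> t \<le> e"
        then have o: "a \<le> s" "s \<le> t" "t \<le> e" by auto
        have "\<bar>w (Z s) - w (Z x)\<bar> < \<rho>" "\<bar>w (Z t) - w (Z x)\<bar> < \<rho>" using d st by auto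
        moreover have "w (Z x) + \<rho> = (1 + \<eta>) * (w (Z x) - \<rho>)"
        proof -
          have "\<rho> * (2 + \<eta>) = \<eta> * w (Z x)" using \<open>\<eta> > 0\<close> by (simp add: \<rho>_def)
          then show ?thesis by (simp add: algebra_simps)
        qed
        moreover have "(1 + \<eta>) * (w (Z x) - \<rho>) \<le> (1 + \<eta>) * w (Z s)"
          using calculation(1) \<open>\<eta> > 0\<close> by (intro mult_left_mono) auto
        ultimately have ratio: "w (Z t) \<le> (1 + \<eta>) * w (Z s)" by linarith
        have ws: "w (Z s) > 0" using Zpos w(3) o by auto
        have "integral {s..t} m \<le> integral {s..t} (\<lambda>r. k r * w (Z t))"
        proof (rule integral_le)
          show "(\<lambda>r. k r * w (Z t)) integrable_on {s..t}"
            using sub(1)[of s t] o by (intro integrable_on_mult_left) auto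
          fix r assume r: "r \<in> {s..t}"
          then have "m r \<le> k r * w (Z r)" using m(2) o by (auto simp: Z_def)
          also have "\<dots> \<le> k r * w (Z t)"
            using r o k Zmono Zpos by (intro mult_left_mono monotone_onD[OF w(2)]) auto
          finally show "m r \<le> k r * w (Z t)" .
        qed (use sub o in auto)
        also have "\<dots> = (K t - K s) * w (Z t)" using Kd[OF o] by simp
        also have "\<dots> \<le> (K t - K s) * ((1 + \<eta>) * w (Z s))"
          using ratio Kmono[OF o] by (intro mult_left_mono) auto
        finally have "Z t - Z s \<le> (1 + \<eta>) * (K t - K s) * w (Z s)"
          using Zd[OF o] by (simp add: mult_ac)
        then have "(Z t - Z s) / w (Z s) \<le> (1 + \<eta>) * (K t - K s)"
          using ws by (simp add: divide_le_eq)
        then show "P (Z t) - P (Z s) \<le> (1 + \<eta>) * (K t - K s)"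
          using P[OF Zpos[of s] Zmono[OF o]] o by simp
      qed (use d in simp)
    qed
    then show ?thesis by (simp add: Q_def)
  qed
  have "P (Z e) - P (Z a) \<le> K e - K a"
  proof (rule field_le_epsilon)
    fix \<epsilon> :: real assume "\<epsilon> > 0"
    have K0: "K e - K a \<ge> 0" using Kmono[of a e] \<open>a \<le> e\<close> by simp
    let ?\<eta> = "\<epsilon> / (K e - K a + 1)"
    have "?\<eta> > 0" using K0 \<open>\<epsilon> > 0\<close> by simp
    from key[OF this] have "P (Z e) - P (Z a) \<le> (K e - K a) + ?\<eta> * (K e - K a)"
      by (simp add: algebra_simps)
    moreover have "?\<eta> * (K e - K a) \<le> \<epsilon>" using K0 \<open>\<epsilon> > 0\<close> by (simp add: field_simps)
    ultimately show "P (Z e) - P (Z a) \<le> K e - K a + \<epsilon>" by simp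
  qed
  then show ?thesis by (simp add: Za Ka) (simp add: Z_def K_def)
qed

lemma (in compact_time_scale) bihari_time_scale:
  fixes k m w P :: "real \<Rightarrow> real"
  assumes e: "e \<in> S" and c: "c > 0"
    and w: "continuous_on {0<..} w" "mono_on {0<..} w" "\<And>x. x > 0 \<Longrightarrow> w x > 0"
    and P: "\<And>x y. 0 < x \<Longrightarrow> x \<le> y \<Longrightarrow> P y - P x \<le> (y - x) / w x"
    and rdc: "rdc e k" "rdc e m"
    and k: "\<And>s. s \<in> S \<Longrightarrow> s < e \<Longrightarrow> 0 \<le> k s"
    and m: "\<And>s. s \<in> S \<Longrightarrow> s < e \<Longrightarrow> 0 \<le> m s"
      "\<And>s. s \<in> S \<Longrightarrow> s < e \<Longrightarrow> m s \<le> k s * w (c + dint s m)"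
  shows "P (c + dint e m) \<le> P c + dint e k"
proof -
  let ?k = "\<lambda>x. if x < e then k (floor_pt x) else 0" and ?m = "\<lambda>x. if x < e then m (floor_pt x) else 0"
  note ik = has_integral_dint[OF e rdc(1)] and im = has_integral_dint[OF e rdc(2)]
  have m0: "0 \<le> ?m x" if "x \<in> {a..e}" for x using m(1) floor_pt_less[OF that] by auto
  have sub: "?m integrable_on {a..x}" if "x \<in> {a..e}" for x
    using integrable_subinterval_real[OF has_integral_integrable[OF im], of a x] that by auto
  have "P (c + integral {a..e} ?m) \<le> P c + integral {a..e} ?k"
  proof (rule bihari_real[OF a_le[OF e] c w P])
    show "?k integrable_on {a..e}" "?m integrable_on {a..e}" using ik im by blast+
    fix x assume x: "x \<in> {a..e}"
    show "0 \<le> ?k x" using k floor_pt_less[OF x] by auto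
    show "0 \<le> ?m x" using m0[OF x] .
    show "?m x \<le> ?k x * w (c + integral {a..x} ?m)"
    proof (cases "x < e")
      case True
      note fl = floor_pt_less[OF x True]
      let ?s = "floor_pt x"
      have "dint ?s m = integral {a..?s} (\<lambda>x. m (floor_pt x))"
        using fl rdc_antimono[OF rdc(2)] by (intro delta_integral_eq) auto
      also have "\<dots> = integral {a..?s} ?m"
        by (rule Henstock_Kurzweil_Integration.integral_cong) (use fl in auto)
      also have "\<dots> \<le> integral {a..x} ?m"
        using sub[of ?s] sub[OF x] fl x a_le_floor_pt[of x] floor_pt_le[of x] m0
        by (intro integral_subset_le) auto
      finally have le: "dint ?s m \<le> integral {a..x} ?m" .
      moreover have "0 \<le> dint ?s m"
        using fl m(1) rdc_antimono[OF rdc(2)] by (intro dint_nonneg) auto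
      ultimately have "w (c + dint ?s m) \<le> w (c + integral {a..x} ?m)"
        using c by (intro monotone_onD[OF w(2)]) auto
      then have "k ?s * w (c + dint ?s m) \<le> k ?s * w (c + integral {a..x} ?m)"
        using k fl by (intro mult_left_mono) auto
      then show ?thesis using m(2)[of ?s] fl True by simp
    qed auto
  qed
  then show ?thesis using ik im by (simp add: integral_unique)
qed

section \<open>Primitives of reciprocals and their inverses\<close>

locale reciprocal_primitive =
  fixes w P :: "real \<Rightarrow> real" and x0 :: real
  assumes w_cont: "continuous_on {0<..} w" and w_mono: "mono_on {0<..} w"
    and w_pos: "\<And>x. x > 0 \<Longrightarrow> w x > 0" and x0_pos: "x0 > 0"
    and P_eq: "\<And>x. x > 0 \<Longrightarrow> P x = (LBINT s=x0..x. 1 / w s)"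
begin

lemmas P_bounds = primitive_inverse_bounds[OF w_cont w_mono w_pos x0_pos P_eq]

lemma P_less:
  assumes "0 < x" "x < y"
  shows "P x < P y"
proof -
  have "0 < (y - x) / w y" using assms w_pos by simp
  then show ?thesis using P_bounds(1)[of x y] assms by simp
qed

lemma P_le_iff: "0 < x \<Longrightarrow> 0 < y \<Longrightarrow> P x \<le> P y \<longleftrightarrow> x \<le> y"
  using P_less by (metis antisym_conv3 linorder_not_less order_le_less)

lemma inj_on_P: "inj_on P {0<..}"
  by (rule inj_onI) (metis P_le_iff antisym greaterThan_iff order_refl)

lemma continuous_on_P:
  assumes "u > 0"
  shows "continuous_on {u..} P"
proof (rule lipschitz_on_continuous_on, rule lipschitz_onI)
  have ordered: "\<bar>P y - P x\<bar> \<le> 1 / w u * \<bar>y - x\<bar>" if "u \<le> x" "x \<le> y" for x y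
  proof -
    have "P y - P x \<le> (y - x) / w x" using P_bounds(2)[of x y] that assms by simp
    also have "\<dots> \<le> (y - x) / w u"
    proof (rule divide_left_mono)
      show "w u \<le> w x" by (rule monotone_onD[OF w_mono]) (use that assms in auto)
    qed (use that assms w_pos in auto)
    finally have "P y - P x \<le> 1 / w u * \<bar>y - x\<bar>" using that by simp
    moreover have "P x \<le> P y" using P_le_iff[of x y] that assms by simp
    ultimately show ?thesis by simp
  qed
  show "dist (P x) (P y) \<le> 1 / w u * dist x y" if "x \<in> {u..}" "y \<in> {u..}" for x y
    using ordered[of x y] ordered[of y x] that by (cases "x \<le> y") (auto simp: dist_real_def abs_minus_commute)
  show "0 \<le> 1 / w u" using w_pos[OF assms] by simp
qed

text \<open>The range condition at the largest value \<open>P c + L\<close> provides a point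
  \<open>Q\<close>; all other values lie between \<open>P c\<close> and \<open>P Q\<close> and are
  attained on \<open>{c..Q}\<close>. On this compact interval the inverse of the continuous
  injection \<open>P\<close> is continuous.\<close>

lemma
  fixes A :: "real \<Rightarrow> real"
  assumes c: "c > 0" and A: "continuous_on X A" "\<And>s. s \<in> X \<Longrightarrow> 0 \<le> A s \<and> A s \<le> L"
    and ran: "P c + L \<in> P ` {0<..}"
  defines "y \<equiv> \<lambda>s. the_inv_into {0<..} P (P c + A s)"
  shows inverse_P_ge: "\<And>s. s \<in> X \<Longrightarrow> c \<le> y s"
    and P_inverse_P: "\<And>s. s \<in> X \<Longrightarrow> P (y s) = P c + A s"
    and continuous_on_inverse_P: "continuous_on X y"
proof -
  obtain Q where Q: "Q > 0" "P Q = P c + L" using ran by auto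
  have cont: "continuous_on {c..Q} P" using continuous_on_P[OF c] by (rule continuous_on_subset) auto
  have inv: "the_inv_into {0<..} P (P x) = x" if "x > 0" for x
    using the_inv_into_f_f[OF inj_on_P] that by simp
  have ex: "\<exists>x\<in>{c..Q}. P x = P c + A s" if "s \<in> X" for s
  proof -
    have "P c \<le> P Q" using A(2)[OF that] Q(2) by simp
    then have "c \<le> Q" using P_le_iff c Q(1) by blast
    then show ?thesis using IVT'[of P c "P c + A s" Q] A(2)[OF that] Q(2) cont by auto
  qed
  show "c \<le> y s" "P (y s) = P c + A s" if s: "s \<in> X" for s
  proof -
    obtain x where x: "x \<in> {c..Q}" "P x = P c + A s" using ex[OF s] by blast
    then have "y s = x" using inv[of x] c unfolding y_def by (metis atLeastAtMost_iff less_le_trans)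
    then show "c \<le> y s" "P (y s) = P c + A s" using x by auto
  qed
  have "continuous_on (P ` {c..Q}) (the_inv_into {0<..} P)"
    by (rule continuous_on_inv[OF cont]) (use inv c in auto)
  then show "continuous_on X y"
    unfolding y_def
    by (rule continuous_on_compose2) (use ex A(1) in \<open>auto intro!: continuous_intros simp: image_iff, metis\<close>)
qed

end

section \<open>The nonlinear integral inequality\<close>

text \<open>\<open>\<alpha>\<close> and \<open>\<beta>\<close> are the functions a(.) and b(.).
  Inverses are taken by \<open>the_inv_into {0<..}\<close>, so the domain of an inverse is the image
  of \<open>{0<..}\<close>. The points in \<open>q_defined\<close> include all those to the left of
  \<rho>(b), which enter \<xi>.\<close>

theorem theorem4:
  fixes T Ts :: "real set" and a b :: real
    and u h f \<alpha> \<beta> :: "real \<Rightarrow> real"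
    and \<Phi> W g :: "real \<Rightarrow> real"
    and \<Psi> G q :: "real \<Rightarrow> real" and x\<^sub>0 \<delta> \<xi> :: real
  assumes T: "time_scale T" and ab: "a \<in> T" "b \<in> T" "a < b"
    and Ts: "Ts = ts_Icc T a b"
    and u: "rd_continuous_on Ts Ts u" "\<And>t. t \<in> Ts \<Longrightarrow> u t \<ge> 0"
    and h: "rd_continuous_on Ts (ts_kappa Ts) h" "\<And>t. t \<in> ts_kappa Ts \<Longrightarrow> h t \<ge> 0"
    and f: "rd_continuous_on Ts (ts_kappa Ts) f" "\<And>t. t \<in> ts_kappa Ts \<Longrightarrow> f t \<ge> 0"
    and \<beta>: "rd_continuous_on Ts (ts_kappa Ts) \<beta>" "\<And>t. t \<in> ts_kappa Ts \<Longrightarrow> \<beta> t \<ge> 0"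
      "\<exists>t\<in>ts_kappa (ts_kappa Ts). \<beta> t \<noteq> 0"
    and \<Phi>: "continuous_on {0..} \<Phi>" "\<Phi> ` {0..} \<subseteq> {0..}" "mono_on {0..} \<Phi>"
      "\<And>x y. x \<ge> 0 \<Longrightarrow> y \<ge> 0 \<Longrightarrow> \<Phi> (x + y) \<le> \<Phi> x + \<Phi> y"
      "\<And>x y. x \<ge> 0 \<Longrightarrow> y \<ge> 0 \<Longrightarrow> \<Phi> (x * y) \<le> \<Phi> x * \<Phi> y"
      "\<And>x. x > 0 \<Longrightarrow> \<Phi> x > 0"
    and W: "continuous_on {0..} W" "W ` {0..} \<subseteq> {0..}" "mono_on {0..} W"
      "\<And>x. x > 0 \<Longrightarrow> W x > 0"
    and g: "class_S g"
    and \<alpha>: "rd_continuous_on Ts Ts \<alpha>" "mono_on Ts \<alpha>" "\<And>t. t \<in> Ts \<Longrightarrow> \<alpha> t > 0"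
    and ineq: "\<And>t. t \<in> Ts \<Longrightarrow>
      u t \<le> \<alpha> t + delta_integral Ts a t (\<lambda>s. f s * g (u s))
        + delta_integral Ts a t (\<lambda>s. f s * h s * W (delta_integral Ts a s (\<lambda>\<tau>. \<beta> \<tau> * \<Phi> (u \<tau>))))"
    and \<Psi>: "x\<^sub>0 > 0" "\<And>x. x > 0 \<Longrightarrow> \<Psi> x = (LBINT s=x\<^sub>0..x. 1 / \<Phi> (W s))"
    and G: "\<delta> > 0" "\<And>x. x > 0 \<Longrightarrow> G x = (LBINT s=\<delta>..x. 1 / g s)"
    and q: "\<And>t. t \<in> Ts \<Longrightarrow> q t = the_inv_into {0<..} G (G 1 + delta_integral Ts a t f)"
    and q_defined: "\<And>s. s \<in> ts_kappa (ts_kappa Ts) \<Longrightarrow> G 1 + delta_integral Ts a s f \<in> G ` {0<..}"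
    and \<xi>: "\<xi> = delta_integral Ts a (bwd_jump Ts b) (\<lambda>s. \<beta> s * \<Phi> (q s * max (\<alpha> s) 1))"
  shows "\<forall>t\<in>Ts.
    G 1 + delta_integral Ts a t f \<in> G ` {0<..} \<longrightarrow>
    \<Psi> \<xi> + delta_integral Ts a (bwd_jump Ts t)
        (\<lambda>\<tau>. \<beta> \<tau> * \<Phi> (q \<tau>) * \<Phi> (delta_integral Ts a \<tau> (\<lambda>\<theta>. f \<theta> * h \<theta>))) \<in> \<Psi> ` {0<..} \<longrightarrow>
    u t \<le> q t * max (\<alpha> t) 1
      + q t * delta_integral Ts a t (\<lambda>s. f s * h s *
          W (the_inv_into {0<..} \<Psi> (\<Psi> \<xi> + delta_integral Ts a s
            (\<lambda>\<tau>. \<beta> \<tau> * \<Phi> (q \<tau>) * \<Phi> (delta_integral Ts a \<tau> (\<lambda>\<theta>. f \<theta> * h \<theta>))))))"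
proof (intro ballI impI)
  have closed_Ts: "closed Ts"
  proof -
    have "Ts = T \<inter> {a..b}" by (auto simp: Ts ts_Icc_def)
    then show ?thesis using T by (auto simp: time_scale_def intro: closed_Int)
  qed
  interpret compact_time_scale Ts a b
    by standard (use closed_Ts ab in \<open>auto simp: Ts ts_Icc_def\<close>)

  define \<rho>b where "\<rho>b = bwd_jump Ts b"
  \<comment> \<open>The largest point of \<open>ts_kappa (ts_kappa Ts)\<close>. No point to the left
    of \<open>\<rho>b\<close> exceeds it, so the range condition at \<open>c\<close> covers all of
    \<xi>.\<close>
  define c where "c = bwd_jump (ts_kappa Ts) \<rho>b"
  have \<rho>b: "\<rho>b \<in> Ts" "\<rho>b \<le> b" "\<And>s. s \<in> Ts \<Longrightarrow> s < b \<Longrightarrow> s \<le> \<rho>b"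
    using bwd_jump_max[OF closed_S b_in] by (auto simp: \<rho>b_def)
  have kap: "ts_kappa Ts = Ts \<inter> {..\<rho>b}"
    unfolding \<rho>b_def using closed_S b_in S_bounds by (intro ts_kappa_eq) auto
  have closed_kap: "closed (ts_kappa Ts)" unfolding kap using closed_S by (intro closed_Int) auto
  have kap_less: "s \<in> ts_kappa Ts" if "s \<in> Ts" "s < b" for s using that \<rho>b(3) by (auto simp: kap)
  have \<rho>b_kap: "\<rho>b \<in> ts_kappa Ts" using \<rho>b by (simp add: kap)
  note cj = bwd_jump_max[OF closed_kap \<rho>b_kap, folded c_def]
  have c: "c \<in> Ts" "c \<le> \<rho>b" "\<And>s. s \<in> Ts \<Longrightarrow> s < \<rho>b \<Longrightarrow> s \<le> c"
    using cj by (auto simp: kap)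
  have kap2: "ts_kappa (ts_kappa Ts) = ts_kappa Ts \<inter> {..c}"
    unfolding c_def using closed_kap \<rho>b_kap by (intro ts_kappa_eq) (auto simp: kap)
  have c_range: "G 1 + dint c f \<in> G ` {0<..}"
  proof (rule q_defined)
    show "c \<in> ts_kappa (ts_kappa Ts)" unfolding kap2 using c by (simp add: kap)
  qed

  have rf: "rdc b f" and rh: "rdc b h" and r\<beta>: "rdc b \<beta>"
    using f(1) h(1) \<beta>(1) kap_less
    by (auto intro!: rd_continuous_on_imp_rdc[where D = "ts_kappa Ts"] closed_kap simp: kap)
  have ru: "rdc b u" and r\<alpha>: "rdc b \<alpha>"
    using u(1) \<alpha>(1) by (auto intro!: rd_continuous_on_imp_rdc[where D = Ts] closed_S)
  have f0: "0 \<le> f s" and h0: "0 \<le> h s" and \<beta>0: "0 \<le> \<beta> s" if "s \<in> Ts" "s < b" for s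
    using f(2) h(2) \<beta>(2) kap_less that by auto

  have g_cont: "continuous_on {0..} g" and g_mono: "mono_on {0..} g"
    and g_pos: "\<And>x. x > 0 \<Longrightarrow> g x > 0" and g_nn: "\<And>x. x \<ge> 0 \<Longrightarrow> g x \<ge> 0"
    and g_S: "\<And>x z. x \<ge> 0 \<Longrightarrow> z \<ge> 1 \<Longrightarrow> g x / z \<le> g (x / z)"
    using g by (auto simp: class_S_def)
  have \<Phi>_nn: "\<Phi> x \<ge> 0" and W_nn: "W x \<ge> 0" if "x \<ge> 0" for x using \<Phi>(2) W(2) that by auto
  have \<Phi>_le: "\<Phi> x \<le> \<Phi> y" and W_le: "W x \<le> W y" and g_le: "g x \<le> g y" if "0 \<le> x" "x \<le> y" for x y
    using that \<Phi>(3) W(3) g_mono by (auto simp: monotone_on_def)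
  define V where "V x = \<Phi> (W x)" for x
  have V_nn: "V x \<ge> 0" if "x \<ge> 0" for x using \<Phi>_nn W_nn that by (simp add: V_def)
  have V_le: "V x \<le> V y" if "0 \<le> x" "x \<le> y" for x y
    using that W_nn W_le \<Phi>_le by (simp add: V_def)
  have V_cont: "continuous_on {0..} V"
    unfolding V_def by (rule continuous_on_compose2[OF \<Phi>(1) W(1)]) (use W_nn in auto)
  interpret GP: reciprocal_primitive g G \<delta>
  proof
    show "continuous_on {0<..} g" using g_cont by (rule continuous_on_subset) auto
    show "mono_on {0<..} g" using g_mono by (rule monotone_on_subset) auto
  qed (use g_pos G in auto)
  interpret PP: reciprocal_primitive V \<Psi> x\<^sub>0
  proof
    show "continuous_on {0<..} V" using V_cont by (rule continuous_on_subset) auto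
    show "mono_on {0<..} V" using V_le by (auto intro!: monotone_onI)
    show "V x > 0" if "x > 0" for x using W(4) \<Phi>(6) that by (simp add: V_def)
  qed (use \<Psi> in \<open>auto simp: V_def\<close>)

  fix t assume t: "t \<in> Ts" and tG: "G 1 + dint t f \<in> G ` {0<..}"
  define E where "E s = dint s (\<lambda>\<theta>. f \<theta> * h \<theta>)" for s
  define p where "p \<tau> = \<beta> \<tau> * \<Phi> (q \<tau>) * \<Phi> (E \<tau>)" for \<tau>
  define y where "y s = the_inv_into {0<..} \<Psi> (\<Psi> \<xi> + dint s p)" for s
  \<comment> \<open>\<open>q\<close> is needed up to \<open>t\<close> and, for \<open>\<xi>\<close>, at all points to the left of \<open>\<rho>b\<close>.\<close>
  define M where "M = max c t"
  have M: "M \<in> Ts" "M \<le> b" and tM: "t \<le> M"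
    using c t \<rho>b le_b by (auto simp: M_def max_def)
  have M_range: "G 1 + dint M f \<in> G ` {0<..}" using tG c_range by (auto simp: M_def max_def)
  have below_\<rho>b: "Ts \<inter> {..<\<rho>b} \<subseteq> {..M}" using c by (force simp: M_def)

  have rf_M: "rdc M f" using rdc_antimono[OF rf M(2)] .
  have A_bounds: "0 \<le> dint s f \<and> dint s f \<le> dint M f" if "s \<in> Ts \<inter> {..M}" for s
  proof -
    have sM: "s \<in> Ts" "s \<le> M" "s \<le> b" using that M by auto
    have "0 \<le> dint s f" using sM f0 rdc_antimono[OF rf] by (intro dint_nonneg) auto
    moreover have "dint s f \<le> dint M f" using sM M f0 rf_M by (intro dint_le_dint) auto
    ultimately show ?thesis by simp
  qed
  have q_inv: "q s = the_inv_into {0<..} G (G 1 + dint s f)" if "s \<in> Ts \<inter> {..M}" for s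
    using q that by simp
  have q_ge: "1 \<le> q s" and G_q: "G (q s) = G 1 + dint s f" if "s \<in> Ts" "s \<le> M" for s
    using GP.inverse_P_ge[OF zero_less_one continuous_on_dint[OF M(1) rf_M] A_bounds M_range, of s]
      GP.P_inverse_P[OF zero_less_one continuous_on_dint[OF M(1) rf_M] A_bounds M_range, of s] that q
    by auto
  have q_cont: "continuous_on (Ts \<inter> {..M}) q"
    by (rule continuous_on_eq[OF GP.continuous_on_inverse_P[OF zero_less_one
            continuous_on_dint[OF M(1) rf_M] A_bounds M_range]]) (use q_inv in auto)
  have rq: "rdc e q" if "Ts \<inter> {..<e} \<subseteq> {..M}" for e by (rule rdc_continuous_on[OF q_cont that])

  \<comment> \<open>First bound: \<open>u\<close> against \<open>q\<close> and
    \<open>n\<close>\<close>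
  define B where "B s = dint s (\<lambda>\<tau>. \<beta> \<tau> * \<Phi> (u \<tau>))" for s
  have r\<Phi>u: "rdc b (\<lambda>\<tau>. \<Phi> (u \<tau>))"
    by (rule rdc_compose[OF ru \<Phi>(1)]) (use u(2) in auto)
  have r\<beta>u: "rdc b (\<lambda>\<tau>. \<beta> \<tau> * \<Phi> (u \<tau>))" by (rule rdc_mult[OF r\<beta> r\<Phi>u])
  have \<beta>u0: "0 \<le> \<beta> s * \<Phi> (u s)" if "s \<in> Ts" "s < b" for s
    using \<beta>0[OF that] \<Phi>_nn u(2) that by simp
  have B_nn: "0 \<le> B s" if "s \<in> Ts" for s
    unfolding B_def using that le_b[OF that] \<beta>u0 rdc_antimono[OF r\<beta>u] by (intro dint_nonneg) auto
  have B_le: "B r \<le> B s" if "r \<in> Ts" "s \<in> Ts" "r \<le> s" for r s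
    unfolding B_def using that le_b[of s] \<beta>u0 rdc_antimono[OF r\<beta>u] by (intro dint_le_dint) auto
  have rB: "rdc b B"
    unfolding B_def by (rule rdc_continuous_on[OF continuous_on_dint[OF b_in r\<beta>u]]) auto
  have rfh: "rdc b (\<lambda>s. f s * h s)" by (rule rdc_mult[OF rf rh])
  have rE: "rdc b E"
    unfolding E_def by (rule rdc_continuous_on[OF continuous_on_dint[OF b_in rfh]]) auto
  have fh0: "0 \<le> f s * h s" if "s \<in> Ts" "s < b" for s using f0 h0 that by simp
  have E_nn: "0 \<le> E s" if "s \<in> Ts" for s
    unfolding E_def using that le_b[OF that] fh0 rdc_antimono[OF rfh] by (intro dint_nonneg) auto

  define C where "C s = dint s (\<lambda>s. f s * h s * W (B s))" for s
  have rWB: "rdc b (\<lambda>s. W (B s))" by (rule rdc_compose[OF rB W(1)]) (use B_nn in auto)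
  have rfhW: "rdc b (\<lambda>s. f s * h s * W (B s))" by (rule rdc_mult[OF rfh rWB])
  have fhW0: "0 \<le> f s * h s * W (B s)" if "s \<in> Ts" "s < b" for s
    using fh0[OF that] W_nn B_nn that by simp
  have C_nn: "0 \<le> C s" if "s \<in> Ts" for s
    unfolding C_def using that le_b[OF that] fhW0 rdc_antimono[OF rfhW] by (intro dint_nonneg) auto
  have C_le: "C r \<le> C s" if "r \<in> Ts" "s \<in> Ts" "r \<le> s" for r s
    unfolding C_def using that le_b[of s] fhW0 rdc_antimono[OF rfhW] by (intro dint_le_dint) auto
  have rC: "rdc b C"
    unfolding C_def by (rule rdc_continuous_on[OF continuous_on_dint[OF b_in rfhW]]) auto

  define n where "n s = max (\<alpha> s) 1 + C s" for s
  have r\<alpha>1: "rdc b (\<lambda>s. max (\<alpha> s) 1)"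
    by (rule rdc_compose[OF r\<alpha>, of UNIV "\<lambda>x. max x 1"]) (auto intro!: continuous_intros)
  have rn: "rdc b n" unfolding n_def by (rule rdc_add[OF r\<alpha>1 rC])
  have n_ge: "1 \<le> n s" if "s \<in> Ts" for s using C_nn[OF that] by (simp add: n_def)
  have n_le: "n r \<le> n s" if "r \<in> Ts" "s \<in> Ts" "r \<le> s" for r s
  proof -
    have "\<alpha> r \<le> \<alpha> s" using \<alpha>(2) that by (auto simp: monotone_on_def)
    then show ?thesis using C_le[OF that] by (simp add: n_def max_def)
  qed
  \<comment> \<open>With this integrand \<open>u / n\<close> is at most 1 plus the integral of
    \<open>m\<close>, and class S yields \<open>m \<le> f * g (1 + dint s m)\<close> at each point
    \<open>s\<close>: the form required by \<open>bihari_time_scale\<close>.\<close>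
  define m where "m s = f s * g (u s) * (1 / n s)" for s
  have rgu: "rdc b (\<lambda>s. g (u s))" by (rule rdc_compose[OF ru g_cont]) (use u(2) in auto)
  have rfgu: "rdc b (\<lambda>s. f s * g (u s))" by (rule rdc_mult[OF rf rgu])
  have rm: "rdc b m"
    unfolding m_def
  proof (rule rdc_mult[OF rfgu])
    show "rdc b (\<lambda>s. 1 / n s)"
      by (rule rdc_compose[OF rn, of "{1..}" "\<lambda>x. 1 / x"]) (use n_ge in \<open>auto intro!: continuous_intros\<close>)
  qed
  have m0: "0 \<le> m s" if "s \<in> Ts" "s < b" for s
    using f0[OF that] g_nn u(2)[OF that(1)] n_ge[OF that(1)] by (simp add: m_def)
  have u_le_n: "u s \<le> n s * (1 + dint s m)" if s: "s \<in> Ts" for s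
  proof -
    have sb: "s \<le> b" using le_b[OF s] .
    \<comment> \<open>Replacing \<open>n r\<close> by the larger \<open>n s\<close> takes the weight
      out of the integral.\<close>
    have "dint s (\<lambda>r. f r * g (u r)) \<le> dint s (\<lambda>r. n s * m r)"
    proof (rule dint_mono[OF s rdc_antimono[OF rfgu sb] rdc_mult[OF rdc_const rdc_antimono[OF rm sb]]])
      fix r assume r: "r \<in> Ts" "r < s"
      have "f r * g (u r) = n r * m r" using n_ge[OF r(1)] by (simp add: m_def)
      also have "\<dots> \<le> n s * m r" using n_le[OF r(1) s] m0[OF r(1)] r sb by (intro mult_right_mono) auto
      finally show "f r * g (u r) \<le> n s * m r" .
    qed
    also have "\<dots> = n s * dint s m" by (rule dint_cmult[OF s rdc_antimono[OF rm sb]])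
    finally have "u s \<le> n s + n s * dint s m"
      using ineq[OF s] by (simp add: n_def C_def B_def)
    then show ?thesis by (simp add: algebra_simps)
  qed
  have u_le_q: "u s \<le> q s * n s" if s: "s \<in> Ts" "s \<le> M" for s
  proof -
    have sb: "s \<le> b" using le_b[OF s(1)] .
    have "G (1 + dint s m) \<le> G 1 + dint s f"
    proof (rule bihari_time_scale[OF s(1) zero_less_one GP.w_cont GP.w_mono GP.w_pos GP.P_bounds(2)])
      show "rdc s f" "rdc s m" using rdc_antimono[OF _ sb] rf rm by auto
      fix r assume r: "r \<in> Ts" "r < s"
      then have rb: "r < b" using sb by simp
      show "0 \<le> f r" "0 \<le> m r" using f0 m0 r rb by auto
      have "g (u r) / n r \<le> g (u r / n r)" using g_S u(2) n_ge r by simp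
      also have "\<dots> \<le> g (1 + dint r m)"
        using u_le_n[OF r(1)] n_ge[OF r(1)] u(2)[OF r(1)] by (intro g_le) (auto simp: divide_le_eq mult.commute)
      finally have "f r * (g (u r) / n r) \<le> f r * g (1 + dint r m)"
        using f0[OF r(1) rb] by (rule mult_left_mono)
      then show "m r \<le> f r * g (1 + dint r m)" by (simp add: m_def)
    qed
    then have "G (1 + dint s m) \<le> G (q s)" using G_q[OF s] by simp
    moreover have "0 \<le> dint s m"
      using m0 sb rdc_antimono[OF rm sb] by (intro dint_nonneg[OF s(1)]) auto
    ultimately have "1 + dint s m \<le> q s" using q_ge[OF s] GP.P_le_iff[of "1 + dint s m" "q s"] by simp
    then have "n s * (1 + dint s m) \<le> n s * q s" using n_ge[OF s(1)] by (intro mult_left_mono) auto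
    then show ?thesis using u_le_n[OF s(1)] by (simp add: mult.commute)
  qed

  \<comment> \<open>Second bound: \<open>B\<close> against the inverse of
    \<open>\<Psi>\<close>\<close>
  define k where "k s = \<beta> s * \<Phi> (q s * max (\<alpha> s) 1)" for s
  have \<xi>_eq: "\<xi> = dint \<rho>b k" by (simp add: \<xi> \<rho>b_def k_def[abs_def])
  \<comment> \<open>Only points to the left of \<open>e\<close> matter, so \<open>e\<close> itself
    may exceed \<open>M\<close>, as can happen for \<open>e = \<rho>b\<close>.\<close>
  have rp: "rdc e p" and rk: "rdc e k"
    if e: "e \<le> b" "Ts \<inter> {..<e} \<subseteq> {..M}" for e
  proof -
    have "rdc e (\<lambda>s. q s * max (\<alpha> s) 1)" by (rule rdc_mult[OF rq[OF e(2)] rdc_antimono[OF r\<alpha>1 e(1)]])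
    then have r: "rdc e (\<lambda>s. \<Phi> (q s * max (\<alpha> s) 1))"
      by (rule rdc_compose[OF _ \<Phi>(1)]) (use q_ge e in \<open>force intro!: mult_nonneg_nonneg\<close>)+
    show "rdc e k" unfolding k_def by (rule rdc_mult[OF rdc_antimono[OF r\<beta> e(1)] r])
    have "rdc e (\<lambda>s. \<Phi> (q s))"
      by (rule rdc_compose[OF rq[OF e(2)] \<Phi>(1)]) (use q_ge e in force)+
    moreover have "rdc e (\<lambda>s. \<Phi> (E s))"
      by (rule rdc_compose[OF rdc_antimono[OF rE e(1)] \<Phi>(1)]) (use E_nn in auto)
    ultimately show "rdc e p"
      unfolding p_def by (intro rdc_mult rdc_antimono[OF r\<beta> e(1)])
  qed
  have k0: "0 \<le> k s" and p0: "0 \<le> p s" if "s \<in> Ts" "s < b" "s \<le> M" for s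
  proof -
    have "1 \<le> q s" using q_ge that by simp
    then have "0 \<le> q s * max (\<alpha> s) 1" by simp
    then show "0 \<le> k s" using \<beta>0[OF that(1,2)] \<Phi>_nn by (simp add: k_def)
    show "0 \<le> p s" using \<beta>0[OF that(1,2)] \<Phi>_nn \<open>1 \<le> q s\<close> E_nn[OF that(1)] by (simp add: p_def)
  qed

  \<comment> \<open>The range condition for \<open>\<Psi>\<close> is given at the backward jump of
    \<open>t\<close>. That is enough: an integral up to \<open>t\<close> sees only points to the
    left of \<open>t\<close>, and none of them exceeds \<open>e\<close>.\<close>
  define e where "e = bwd_jump Ts t"
  have e: "e \<in> Ts" "e \<le> t" "\<And>s. s \<in> Ts \<Longrightarrow> s < t \<Longrightarrow> s \<le> e"
    using bwd_jump_max[OF closed_S t] by (auto simp: e_def)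
  \<comment> \<open>Hence \<xi>, the integral of \<open>k\<close> up to \<open>\<rho>b\<close>,
    dominates the integral of \<open>k\<close> up to each \<open>s \<le> e\<close>.\<close>
  have e\<rho>: "e \<le> \<rho>b"
  proof (cases "t = b")
    case False
    then have "t \<le> \<rho>b" using \<rho>b(3)[OF t] le_b[OF t] by simp
    then show ?thesis using e by simp
  qed (simp add: e_def \<rho>b_def)
  have eM: "e \<le> M" using e tM by simp
  have eb: "e \<le> b" using le_b[OF e(1)] .
  have rp_s: "rdc s p" and rk_s: "rdc s k" if "s \<in> Ts" "s \<le> e" for s
    using that eM eb by (intro rp rk; force)+
  have \<xi>_nn: "0 \<le> \<xi>"
    unfolding \<xi>_eq using \<rho>b below_\<rho>b k0 by (intro dint_nonneg rk) (auto simp: subset_iff)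

  assume "\<Psi> \<xi> + delta_integral Ts a (bwd_jump Ts t)
        (\<lambda>\<tau>. \<beta> \<tau> * \<Phi> (q \<tau>) * \<Phi> (delta_integral Ts a \<tau> (\<lambda>\<theta>. f \<theta> * h \<theta>))) \<in> \<Psi> ` {0<..}"
  then have e_range: "\<Psi> \<xi> + dint e p \<in> \<Psi> ` {0<..}" by (simp add: e_def p_def[abs_def] E_def)

  \<comment> \<open>The common outcome of both cases. It stays silent about \<open>y t\<close>,
    because the range condition need not extend to \<open>t\<close>.\<close>
  have "(\<forall>s\<in>Ts. s < t \<longrightarrow> B s \<le> y s) \<and> rdc t y"
  proof (cases "\<xi> > 0")
    case True
    have R_bounds: "0 \<le> dint s p \<and> dint s p \<le> dint e p" if "s \<in> Ts \<inter> {..e}" for s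
    proof -
      have s: "s \<in> Ts" "s \<le> e" using that by auto
      have "0 \<le> dint s p" using s rp_s p0 eb eM by (intro dint_nonneg) auto
      moreover have "dint s p \<le> dint e p" using s e rp_s p0 eb eM by (intro dint_le_dint) auto
      ultimately show ?thesis by simp
    qed
    have rp_e: "rdc e p" using rp_s e by simp
    note inv = True continuous_on_dint[OF e(1) rp_e] R_bounds e_range
    have y_cont: "continuous_on (Ts \<inter> {..e}) y"
      unfolding y_def by (rule PP.continuous_on_inverse_P[OF inv])
    have y_ge: "\<xi> \<le> y s" and \<Psi>_y: "\<Psi> (y s) = \<Psi> \<xi> + dint s p" if "s \<in> Ts" "s \<le> e" for s
      using PP.inverse_P_ge[OF inv, of s] PP.P_inverse_P[OF inv, of s] that by (auto simp: y_def)
    \<comment> \<open>The feedback part of \<open>B\<close>: once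
      \<open>B s \<le> \<xi> + dint s m2\<close> is known, monotonicity of \<open>V\<close> gives
      \<open>m2 s \<le> p s * V (\<xi> + dint s m2)\<close>.\<close>
    define m2 where "m2 s = p s * V (B s)" for s
    have rVB: "rdc b (\<lambda>s. V (B s))" by (rule rdc_compose[OF rB V_cont]) (use B_nn in auto)
    have rm2: "rdc s m2" if "s \<in> Ts" "s \<le> e" for s
      unfolding m2_def by (rule rdc_mult[OF rp_s[OF that] rdc_antimono[OF rVB]]) (use that eb in simp)
    have m20: "0 \<le> m2 s" if "s \<in> Ts" "s < e" for s
      unfolding m2_def using p0[of s] that eb eM V_nn B_nn by simp
    have \<Phi>u: "\<Phi> (u s) \<le> \<Phi> (q s * max (\<alpha> s) 1) + \<Phi> (q s) * \<Phi> (E s) * V (B s)" if s: "s \<in> Ts" "s \<le> e" for s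
    proof -
      have sb: "s \<le> b" using le_b[OF s(1)] .
      have q1: "1 \<le> q s" using q_ge s eM by simp
      \<comment> \<open>As \<open>B\<close> is nondecreasing, \<open>W (B s)\<close> dominates the
        factor inside the integral and can be taken out, which leaves \<open>E s\<close>.\<close>
      have "C s \<le> dint s (\<lambda>r. W (B s) * (f r * h r))"
        unfolding C_def
      proof (rule dint_mono[OF s(1) rdc_antimono[OF rfhW sb] rdc_mult[OF rdc_const rdc_antimono[OF rfh sb]]])
        fix r assume r: "r \<in> Ts" "r < s"
        have "W (B r) \<le> W (B s)" using B_nn B_le r s by (intro W_le) auto
        then show "f r * h r * W (B r) \<le> W (B s) * (f r * h r)"
          using mult_left_mono[of "W (B r)" "W (B s)" "f r * h r"] fh0[of r] r sb by (simp add: mult.commute)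
      qed
      also have "\<dots> = E s * W (B s)"
        using dint_cmult[OF s(1) rdc_antimono[OF rfh sb]] by (simp add: E_def mult.commute)
      finally have C: "C s \<le> E s * W (B s)" .
      have "u s \<le> q s * max (\<alpha> s) 1 + q s * C s"
        using u_le_q[of s] s eM by (simp add: n_def algebra_simps)
      then have "\<Phi> (u s) \<le> \<Phi> (q s * max (\<alpha> s) 1 + q s * C s)" using u(2)[OF s(1)] by (intro \<Phi>_le)
      also have "\<dots> \<le> \<Phi> (q s * max (\<alpha> s) 1) + \<Phi> (q s * C s)"
        using q1 C_nn[OF s(1)] by (intro \<Phi>(4)) auto
      also have "\<Phi> (q s * C s) \<le> \<Phi> (q s) * \<Phi> (C s)"
        using q1 C_nn[OF s(1)] by (intro \<Phi>(5)) auto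
      also have "\<Phi> (q s) * \<Phi> (C s) \<le> \<Phi> (q s) * (\<Phi> (E s) * V (B s))"
      proof (rule mult_left_mono)
        have "\<Phi> (C s) \<le> \<Phi> (E s * W (B s))" using C C_nn[OF s(1)] by (intro \<Phi>_le)
        also have "\<dots> \<le> \<Phi> (E s) * V (B s)"
          unfolding V_def using E_nn[OF s(1)] W_nn B_nn[OF s(1)] by (intro \<Phi>(5)) auto
        finally show "\<Phi> (C s) \<le> \<Phi> (E s) * V (B s)" .
      qed (use \<Phi>_nn q1 in auto)
      finally show ?thesis by (simp add: mult.assoc)
    qed
    have B_le_m2: "B s \<le> \<xi> + dint s m2" if s: "s \<in> Ts" "s \<le> e" for s
    proof -
      have sb: "s \<le> b" using le_b[OF s(1)] .
      have "B s \<le> dint s (\<lambda>r. k r + m2 r)"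
        unfolding B_def
      proof (rule dint_mono[OF s(1) rdc_antimono[OF r\<beta>u sb] rdc_add[OF rk_s[OF s] rm2[OF s]]])
        fix r assume r: "r \<in> Ts" "r < s"
        then have "\<beta> r * \<Phi> (u r) \<le> \<beta> r * (\<Phi> (q r * max (\<alpha> r) 1) + \<Phi> (q r) * \<Phi> (E r) * V (B r))"
          using \<beta>0[of r] \<Phi>u[of r] s sb by (intro mult_left_mono) auto
        then show "\<beta> r * \<Phi> (u r) \<le> k r + m2 r" by (simp add: k_def m2_def p_def algebra_simps)
      qed
      also have "\<dots> = dint s k + dint s m2" by (rule dint_add[OF s(1) rk_s[OF s] rm2[OF s]])
      also have "dint s k \<le> \<xi>"
        unfolding \<xi>_eq using s \<rho>b e\<rho> below_\<rho>b k0
        by (intro dint_le_dint rk) (auto simp: subset_iff)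
      finally show ?thesis by simp
    qed
    have B_le_y: "B s \<le> y s" if s: "s \<in> Ts" "s \<le> e" for s
    proof -
      have "\<Psi> (\<xi> + dint s m2) \<le> \<Psi> \<xi> + dint s p"
      proof (rule bihari_time_scale[OF s(1) True PP.w_cont PP.w_mono PP.w_pos PP.P_bounds(2)])
        show "rdc s p" "rdc s m2" using rp_s[OF s] rm2[OF s] .
        fix r assume r: "r \<in> Ts" "r < s"
        show "0 \<le> p r" "0 \<le> m2 r" using p0[of r] m20[of r] r s eb eM by auto
        have "V (B r) \<le> V (\<xi> + dint r m2)" using B_le_m2[of r] B_nn[of r] r s by (intro V_le) auto
        then show "m2 r \<le> p r * V (\<xi> + dint r m2)"
          unfolding m2_def using \<open>0 \<le> p r\<close> by (rule mult_left_mono)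
      qed
      then have "\<Psi> (\<xi> + dint s m2) \<le> \<Psi> (y s)" using \<Psi>_y[OF s] by simp
      moreover have "0 \<le> dint s m2" using s m20 rm2 by (intro dint_nonneg) auto
      ultimately have "\<xi> + dint s m2 \<le> y s"
        using y_ge[OF s] True PP.P_le_iff[of "\<xi> + dint s m2" "y s"] by simp
      then show ?thesis using B_le_m2[OF s] by simp
    qed
    have "rdc t y" by (rule rdc_continuous_on[OF y_cont]) (use e in auto)
    then show ?thesis using B_le_y e by auto
  next
    \<comment> \<open>If \<open>\<xi> = 0\<close> then \<open>\<Psi> \<xi>\<close> is an unspecified value, but \<open>B\<close> vanishes to the left of \<open>t\<close>, and
      \<open>y\<close> is positive merely because \<open>\<Psi> \<xi>\<close> lies in the range of \<open>\<Psi>\<close>.  This happens for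
      \<open>Ts = {a, b}\<close>, for example.\<close>
    case False
    then have \<xi>0: "dint \<rho>b k = 0" using \<xi>_nn \<xi>_eq by simp
    \<comment> \<open>The argument of \<open>\<Phi>\<close> in \<open>k\<close> is at least 1, so
      \<open>k\<close> dominates the positive multiple \<open>\<Phi> 1 * \<beta>\<close> and its
      vanishing integral forces that of \<open>\<beta>\<close> to vanish.\<close>
    have \<beta>_zero: "dint s \<beta> = 0" if s: "s \<in> Ts" "s \<le> e" for s
    proof -
      have sb: "s \<le> b" using le_b[OF s(1)] .
      have r\<beta>s: "rdc s \<beta>" using rdc_antimono[OF r\<beta> sb] .
      have "\<Phi> 1 * dint s \<beta> = dint s (\<lambda>r. \<Phi> 1 * \<beta> r)" by (rule dint_cmult[OF s(1) r\<beta>s, symmetric])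
      also have "\<dots> \<le> dint s k"
      proof (rule dint_mono[OF s(1) rdc_mult[OF rdc_const r\<beta>s] rk_s[OF s]])
        fix r assume r: "r \<in> Ts" "r < s"
        have "1 \<le> q r" using q_ge[of r] r s eM by simp
        then have "1 * 1 \<le> q r * max (\<alpha> r) 1" by (intro mult_mono) auto
        then have "\<Phi> 1 \<le> \<Phi> (q r * max (\<alpha> r) 1)" by (intro \<Phi>_le) auto
        moreover have "0 \<le> \<beta> r" using \<beta>0[of r] r sb by simp
        ultimately have "\<beta> r * \<Phi> 1 \<le> k r" unfolding k_def by (rule mult_left_mono)
        then show "\<Phi> 1 * \<beta> r \<le> k r" by (simp add: mult.commute)
      qed
      also have "dint s k \<le> dint \<rho>b k"
        using s \<rho>b e\<rho> below_\<rho>b k0 by (intro dint_le_dint rk) (auto simp: subset_iff)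
      finally have "\<Phi> 1 * dint s \<beta> \<le> 0" using \<xi>0 by simp
      then have "dint s \<beta> \<le> 0" using \<Phi>(6)[of 1] by (simp add: mult_le_0_iff)
      moreover have "0 \<le> dint s \<beta>" using s sb \<beta>0 r\<beta>s by (intro dint_nonneg) auto
      ultimately show ?thesis by simp
    qed
    have zero: "B s = 0" "dint s p = 0" if s: "s \<in> Ts" "s \<le> e" for s
    proof -
      have sb: "s \<le> b" using le_b[OF s(1)] .
      have nn: "0 \<le> \<beta> r" if "r \<in> Ts" "r < s" for r using \<beta>0[of r] that sb by simp
      note z = dint_mult_eq_0[OF s(1) rdc_antimono[OF r\<beta> sb] _ nn \<beta>_zero[OF s]]
      show "B s = 0" unfolding B_def by (rule z[OF rdc_antimono[OF r\<Phi>u sb]])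
      have sM: "Ts \<inter> {..<s} \<subseteq> {..M}" using s eM by auto
      have "rdc s (\<lambda>r. \<Phi> (q r))"
        by (rule rdc_compose[OF rq[OF sM] \<Phi>(1)]) (use q_ge s eM in force)+
      moreover have "rdc s (\<lambda>r. \<Phi> (E r))"
        by (rule rdc_compose[OF rdc_antimono[OF rE sb] \<Phi>(1)]) (use E_nn in auto)
      ultimately have "dint s (\<lambda>r. \<beta> r * (\<Phi> (q r) * \<Phi> (E r))) = 0" by (intro z rdc_mult)
      then show "dint s p = 0" by (simp add: p_def[abs_def] mult.assoc)
    qed
    define y0 where "y0 = the_inv_into {0<..} \<Psi> (\<Psi> \<xi>)"
    have "\<Psi> \<xi> \<in> \<Psi> ` {0<..}" using e_range zero(2)[OF e(1)] by simp
    then have "y0 \<in> {0<..}"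
      unfolding y0_def by (rule the_inv_into_into[OF PP.inj_on_P]) simp
    then have "B s \<le> y s" "y s = y0" if "s \<in> Ts" "s < t" for s
      using zero[of s] e that by (auto simp: y_def y0_def)
    moreover from this(2) have "rdc t y"
      using rdc_cong[of t y "\<lambda>_. y0"] rdc_const by simp
    ultimately show ?thesis by blast
  qed
  then have B_le_y: "\<And>s. s \<in> Ts \<Longrightarrow> s < t \<Longrightarrow> B s \<le> y s" and ry: "rdc t y" by auto
  have tb: "t \<le> b" using le_b[OF t] .
  have "C t \<le> dint t (\<lambda>s. f s * h s * W (y s))"
    unfolding C_def
  proof (rule dint_mono[OF t rdc_antimono[OF rfhW tb]])
    \<comment> \<open>Nonnegativity of \<open>y\<close>, needed to stay in the domain of
      \<open>W\<close>, is inherited from \<open>B\<close> in both cases.\<close>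
    have "rdc t (\<lambda>s. W (y s))"
    proof (rule rdc_compose[OF ry W(1)])
      show "y s \<in> {0..}" if "s \<in> Ts" "s < t" for s
        using order_trans[OF B_nn B_le_y] that by simp
    qed simp
    then show "rdc t (\<lambda>s. f s * h s * W (y s))" by (rule rdc_mult[OF rdc_antimono[OF rfh tb]])
    fix s assume s: "s \<in> Ts" "s < t"
    show "f s * h s * W (B s) \<le> f s * h s * W (y s)"
      using s tb fh0[of s] B_nn B_le_y by (intro mult_left_mono W_le) auto
  qed
  then have "q t * C t \<le> q t * dint t (\<lambda>s. f s * h s * W (y s))"
    using q_ge[OF t tM] by (intro mult_left_mono) auto
  moreover have "u t \<le> q t * max (\<alpha> t) 1 + q t * C t"
    using u_le_q[OF t tM] by (simp add: n_def algebra_simps)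
  ultimately show "u t \<le> q t * max (\<alpha> t) 1
      + q t * delta_integral Ts a t (\<lambda>s. f s * h s *
          W (the_inv_into {0<..} \<Psi> (\<Psi> \<xi> + delta_integral Ts a s
            (\<lambda>\<tau>. \<beta> \<tau> * \<Phi> (q \<tau>) * \<Phi> (delta_integral Ts a \<tau> (\<lambda>\<theta>. f \<theta> * h \<theta>))))))"
    by (simp add: y_def p_def[abs_def] E_def)
qed

end
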